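(* Let $\Lambda>0$, $H_0\equiv\frac12I$ on $[0,\Lambda]$, and let $q\in L^1(0,\Lambda)\cap L^\infty(0,\Lambda)$ be complex-valued. Then for every $z\in\mathbb{C}$ with $\operatorname{Im}z>0$, $$Dv_{H_0,\Lambda}(z)[q]=-iz\int_0^\Lambda q(s)e^{izs}\,ds .$$ For fixed $z$ with $\operatorname{Im}z>0$, the right-hand side defines a bounded linear functional of $q$ on $L^1(0,\Lambda)$; thus the formula extends uniquely by continuity from $L^1\cap L^\infty$ to all of $L^1(0,\Lambda)$.
   Context: Let $J=\begin{pmatrix}0&-1\\1&0\end{pmatrix}$. A trace-normed Hamiltonian on $[0,\Lambda]$ is a measurable $H:[0,\Lambda]\to\mathbb{R}^{2\times2}$ with $H(s)$ symmetric, $H(s)\succeq0$ and $\operatorname{tr}H(s)=1$ for a.e. $s$; it is extended to $[0,\infty)$ by the free tail $H(s)=\frac12I$ for $s\ge\Lambda$. For $\operatorname{Im}z>0$, the Weyl coefficient $m_{H,\Lambda}(z)$ is the unique $m\in\mathbb{C}$ such that the solution of $JY'(s)=zH(s)Y(s)$ on $[0,\infty)$ with $Y(0)=(1,m)^\top$ is square-integrable, i.e. $\int_0^\infty Y^*HY\,ds<\infty$; it satisfies $\operatorname{Im}m_{H,\Lambda}(z)>0$. Its Schur transform is $v_{H,\Lambda}(z)=\dfrac{m_{H,\Lambda}(z)-i}{m_{H,\Lambda}(z)+i}$. For $q\in\mathbb{C}$, $X_q:=\begin{pmatrix}\operatorname{Re}q&\operatorname{Im}q\\ \operatorname{Im}q&-\operatorname{Re}q\end{pmatrix}$.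 $Dv_{H_0,\Lambda}(z)[q]$ is the derivative at $\tau=0$ (real $\tau$) of $\tau\mapsto v_{H_0+\tau X_q,\Lambda}(z)$; for bounded $q$ and small real $\tau$, $H_0+\tau X_q$ is a trace-normed Hamiltonian. The extension to $L^1$ is a statement about the linear functional only, not about the derivative. *)

theory Defs
  imports "HOL-Analysis.Analysis"
begin

definition J_mat :: "complex^2^2" where
  "J_mat = vector [vector [0, -1], vector [1, 0]]"

definition trace_normed_hamiltonian :: "real \<Rightarrow> (real \<Rightarrow> real^2^2) \<Rightarrow> bool" where
  "trace_normed_hamiltonian \<Lambda> H \<longleftrightarrow>
     H \<in> borel_measurable (lebesgue_on {0..\<Lambda>}) \<and>
     (AE s in lebesgue_on {0..\<Lambda>}.
        transpose (H s) = H s \<and> (\<forall>x. 0 \<le> x \<bullet> (H s *v x)) \<and> trace (H s) = 1)"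

definition free_tail :: "real \<Rightarrow> (real \<Rightarrow> real^2^2) \<Rightarrow> real \<Rightarrow> real^2^2" where
  "free_tail \<Lambda> H s = (if s < \<Lambda> then H s else mat (1/2))"

text \<open>
  Since \<open>H\<close> is only measurable, the equation \<open>J Y' = z H Y\<close> on \<open>[0,\<infinity>)\<close> is understood in the
  Caratheodory sense: \<open>Y\<close> is locally absolutely continuous, i.e. the indefinite integral of a
  locally integrable function \<open>Y'\<close>, and the equation holds almost everywhere.
\<close>

definition canonical_solution ::
  "(real \<Rightarrow> real^2^2) \<Rightarrow> complex \<Rightarrow> (real \<Rightarrow> complex^2) \<Rightarrow> bool" where
  "canonical_solution H z Y \<longleftrightarrow>
     (\<exists>Y'. (\<forall>t\<ge>0. Y' absolutely_integrable_on {0..t} \<and> Y t = Y 0 + integral {0..t} Y') \<and>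
           (AE s in lebesgue_on {0..}.
              J_mat *v Y' s = z *s (map_matrix complex_of_real (H s) *v Y s)))"

text \<open>The integrand \<open>Y* H Y\<close>; it is real and nonnegative whenever \<open>H s\<close> is positive semidefinite.\<close>

definition energy_density ::
  "(real \<Rightarrow> real^2^2) \<Rightarrow> (real \<Rightarrow> complex^2) \<Rightarrow> real \<Rightarrow> complex" where
  "energy_density H Y s =
     (\<Sum>i\<in>UNIV. cnj (Y s $ i) * (map_matrix complex_of_real (H s) *v Y s) $ i)"

definition weyl_coefficient :: "(real \<Rightarrow> real^2^2) \<Rightarrow> real \<Rightarrow> complex \<Rightarrow> complex" where
  "weyl_coefficient H \<Lambda> z =
     (THE m. \<exists>Y. canonical_solution (free_tail \<Lambda> H) z Y \<and> Y 0 = vector [1, m] \<and>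
                 energy_density (free_tail \<Lambda> H) Y absolutely_integrable_on {0..})"

definition schur_transform :: "(real \<Rightarrow> real^2^2) \<Rightarrow> real \<Rightarrow> complex \<Rightarrow> complex" where
  "schur_transform H \<Lambda> z =
     (weyl_coefficient H \<Lambda> z - \<i>) / (weyl_coefficient H \<Lambda> z + \<i>)"

definition X_mat :: "complex \<Rightarrow> real^2^2" where
  "X_mat q = vector [vector [Re q, Im q], vector [Im q, - Re q]]"

definition perturbed :: "(real \<Rightarrow> real^2^2) \<Rightarrow> (real \<Rightarrow> complex) \<Rightarrow> real \<Rightarrow> real \<Rightarrow> real^2^2" where
  "perturbed H q \<tau> s = H s + \<tau> *\<^sub>R X_mat (q s)"

definition D_schur ::
  "(real \<Rightarrow> real^2^2) \<Rightarrow> real \<Rightarrow> complex \<Rightarrow> (real \<Rightarrow> complex) \<Rightarrow> complex" where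
  "D_schur H \<Lambda> z q = vector_derivative (\<lambda>\<tau>. schur_transform (perturbed H q \<tau>) \<Lambda> z) (at 0)"

text \<open>
  \<open>L\<^sup>1(0,\<Lambda>)\<close> and \<open>L\<^sup>\<infinity>(0,\<Lambda>)\<close> are sets of representatives. A functional that is bounded or
  continuous for the seminorm \<open>L1_norm\<close> in the sense below respects equality almost everywhere,
  so it is the same thing as a functional on equivalence classes.
\<close>

definition L1 :: "real \<Rightarrow> (real \<Rightarrow> complex) set" where
  "L1 \<Lambda> = {q. q absolutely_integrable_on {0..\<Lambda>}}"

definition Linf :: "real \<Rightarrow> (real \<Rightarrow> complex) set" where
  "Linf \<Lambda> = {q. q \<in> borel_measurable (lebesgue_on {0..\<Lambda>}) \<and>
                (\<exists>C. AE s in lebesgue_on {0..\<Lambda>}. norm (q s) \<le> C)}"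

definition L1_norm :: "real \<Rightarrow> (real \<Rightarrow> complex) \<Rightarrow> real" where
  "L1_norm \<Lambda> q = integral {0..\<Lambda>} (\<lambda>s. norm (q s))"

definition L1_bounded_linear :: "real \<Rightarrow> ((real \<Rightarrow> complex) \<Rightarrow> complex) \<Rightarrow> bool" where
  "L1_bounded_linear \<Lambda> F \<longleftrightarrow>
     (\<forall>q\<in>L1 \<Lambda>. \<forall>r\<in>L1 \<Lambda>. F (\<lambda>s. q s + r s) = F q + F r) \<and>
     (\<forall>c. \<forall>q\<in>L1 \<Lambda>. F (\<lambda>s. c * q s) = c * F q) \<and>
     (\<exists>C. \<forall>q\<in>L1 \<Lambda>. norm (F q) \<le> C * L1_norm \<Lambda> q)"

definition L1_continuous :: "real \<Rightarrow> ((real \<Rightarrow> complex) \<Rightarrow> complex) \<Rightarrow> bool" where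
  "L1_continuous \<Lambda> F \<longleftrightarrow>
     (\<forall>q\<in>L1 \<Lambda>. \<forall>\<epsilon>>0. \<exists>\<delta>>0. \<forall>r\<in>L1 \<Lambda>.
        L1_norm \<Lambda> (\<lambda>s. r s - q s) < \<delta> \<longrightarrow> norm (F r - F q) < \<epsilon>)"

text \<open>
  The perturbations entering the derivative at the free Hamiltonian are trace-normed Hamiltonians
  for all small \<open>\<tau>\<close>.
\<close>

lemma quadratic_form_perturbed:
  assumes "H s = mat (1/2)"
  shows "x \<bullet> (perturbed H q \<tau> s *v x) =
    ((x$1)^2 + (x$2)^2) / 2 + \<tau> * (Re (q s) * ((x$1)^2 - (x$2)^2) + Im (q s) * (2 * x$1 * x$2))"
  using assms
  by (simp add: perturbed_def X_mat_def inner_vec_def matrix_vector_mult_def sum_2 mat_def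
      power2_eq_square algebra_simps)

lemma trace_normed_perturbed:
  assumes H: "\<And>s. s \<in> {0..\<Lambda>} \<Longrightarrow> H s = mat (1/2)" and q: "q \<in> Linf \<Lambda>"
  shows "\<forall>\<^sub>F \<tau> in nhds 0. trace_normed_hamiltonian \<Lambda> (perturbed H q \<tau>)"
proof -
  obtain C where C: "AE s in lebesgue_on {0..\<Lambda>}. norm (q s) \<le> C"
    and qm: "q \<in> borel_measurable (lebesgue_on {0..\<Lambda>})"
    using q by (auto simp: Linf_def)
  have good: "transpose (perturbed H q \<tau> s) = perturbed H q \<tau> s \<and>
      (\<forall>x. 0 \<le> x \<bullet> (perturbed H q \<tau> s *v x)) \<and> trace (perturbed H q \<tau> s) = 1"
    if s: "s \<in> {0..\<Lambda>}" "norm (q s) \<le> C" and \<tau>: "\<bar>\<tau>\<bar> * (2 * \<bar>C\<bar> + 1) \<le> 1/2" for s \<tau>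
  proof (intro conjI allI)
    show "transpose (perturbed H q \<tau> s) = perturbed H q \<tau> s" "trace (perturbed H q \<tau> s) = 1"
      using H[OF s(1)]
      by (simp_all add: perturbed_def X_mat_def transpose_def vec_eq_iff forall_2 trace_def sum_2 mat_def)
    fix x :: "real^2"
    let ?n = "(x$1)^2 + (x$2)^2"
    let ?e = "Re (q s) * ((x$1)^2 - (x$2)^2) + Im (q s) * (2 * x$1 * x$2)"
    have n0: "0 \<le> ?n" by simp
    have a1: "\<bar>(x$1)^2 - (x$2)^2\<bar> \<le> ?n" by (simp add: abs_le_iff)
    have a2: "\<bar>2 * x$1 * x$2\<bar> \<le> ?n"
      using sum_squares_bound[of "x$1" "x$2"] sum_squares_bound[of "- (x$1)" "x$2"]
      by (simp add: abs_le_iff)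
    have r: "\<bar>Re (q s)\<bar> \<le> \<bar>C\<bar>" "\<bar>Im (q s)\<bar> \<le> \<bar>C\<bar>"
      using s(2) abs_Re_le_cmod[of "q s"] abs_Im_le_cmod[of "q s"] by linarith+
    have "\<bar>?e\<bar> \<le> \<bar>Re (q s) * ((x$1)^2 - (x$2)^2)\<bar> + \<bar>Im (q s) * (2 * x$1 * x$2)\<bar>"
      by (rule abs_triangle_ineq)
    also have "\<dots> \<le> \<bar>C\<bar> * ?n + \<bar>C\<bar> * ?n"
      unfolding abs_mult[of "Re (q s)"] abs_mult[of "Im (q s)"]
      by (intro add_mono mult_mono a1 a2 r) auto
    also have "\<dots> \<le> (2 * \<bar>C\<bar> + 1) * ?n" using n0 by (simp add: algebra_simps)
    finally have e: "\<bar>?e\<bar> \<le> (2 * \<bar>C\<bar> + 1) * ?n" .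
    have "\<bar>\<tau> * ?e\<bar> \<le> \<bar>\<tau>\<bar> * ((2 * \<bar>C\<bar> + 1) * ?n)"
      unfolding abs_mult[of \<tau>] by (intro mult_left_mono e) auto
    also have "\<dots> = (\<bar>\<tau>\<bar> * (2 * \<bar>C\<bar> + 1)) * ?n" by simp
    also have "\<dots> \<le> (1/2) * ?n" by (intro mult_right_mono \<tau> n0)
    finally show "0 \<le> x \<bullet> (perturbed H q \<tau> s *v x)"
      unfolding quadratic_form_perturbed[where H=H and s=s, OF H[OF s(1)]] by linarith
  qed
  have meas: "perturbed H q \<tau> \<in> borel_measurable (lebesgue_on {0..\<Lambda>})" for \<tau>
  proof -
    have X: "continuous_on UNIV X_mat"
    proof -
      have "X_mat = (\<lambda>w. \<chi> i j. if i = 1 then (if j = 1 then Re w else Im w)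
                                 else (if j = 1 then Im w else - Re w))"
        by (auto simp: X_mat_def vec_eq_iff forall_2)
      moreover have "continuous_on UNIV (\<lambda>w. (\<chi> i j. if i = 1 then (if j = 1 then Re w else Im w)
                                 else (if j = 1 then Im w else - Re w)) :: real^2^2)"
      proof (intro continuous_on_vec_lambda)
        fix i j :: 2
        show "continuous_on UNIV (\<lambda>w. if i = 1 then (if j = 1 then Re w else Im w)
                                 else (if j = 1 then Im w else - Re w))"
          by (cases "i = 1"; cases "j = 1") (auto intro!: continuous_intros)
      qed
      ultimately show ?thesis by (simp only:)
    qed
    have "(\<lambda>s. mat (1/2) + \<tau> *\<^sub>R X_mat (q s)) \<in> borel_measurable (lebesgue_on {0..\<Lambda>})"
      by (intro borel_measurable_add borel_measurable_scaleR borel_measurable_const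
          borel_measurable_continuous_on[OF X] qm)
    then show ?thesis
      by (subst measurable_cong[where g="\<lambda>s. mat (1/2) + \<tau> *\<^sub>R X_mat (q s)"])
         (auto simp: perturbed_def H)
  qed
  have small: "\<forall>\<^sub>F \<tau> in nhds (0::real). \<bar>\<tau>\<bar> * (2 * \<bar>C\<bar> + 1) < 1/2"
  proof (rule order_tendstoD(2))
    have "continuous_on UNIV (\<lambda>\<tau>::real. \<bar>\<tau>\<bar> * (2 * \<bar>C\<bar> + 1))" by (intro continuous_intros)
    then show "((\<lambda>\<tau>::real. \<bar>\<tau>\<bar> * (2 * \<bar>C\<bar> + 1)) \<longlongrightarrow> 0) (nhds 0)"
      by (auto intro!: tendsto_eq_intros simp: filterlim_ident)
  qed simp
  show ?thesis
  proof (rule eventually_mono[OF small])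
    fix \<tau> :: real assume \<tau>: "\<bar>\<tau>\<bar> * (2 * \<bar>C\<bar> + 1) < 1/2"
    have "AE s in lebesgue_on {0..\<Lambda>}. s \<in> {0..\<Lambda>}" by (rule AE_I2) simp
    with C have "AE s in lebesgue_on {0..\<Lambda>}. transpose (perturbed H q \<tau> s) = perturbed H q \<tau> s \<and>
      (\<forall>x. 0 \<le> x \<bullet> (perturbed H q \<tau> s *v x)) \<and> trace (perturbed H q \<tau> s) = 1"
      by (rule eventually_elim2) (rule good[OF _ _ less_imp_le[OF \<tau>]])
    then show "trace_normed_hamiltonian \<Lambda> (perturbed H q \<tau>)"
      unfolding trace_normed_hamiltonian_def using meas by blast
  qed
qed

end

theory Submission
  imports Defs
begin

text \<open>
  Put \<open>a = Y\<^sub>1 + i Y\<^sub>2\<close>, \<open>b = Y\<^sub>1 - i Y\<^sub>2\<close> and remove the free evolution by setting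
  \<open>\<alpha> = exp(izt/2) a\<close>, \<open>\<beta> = exp(-izt/2) b\<close>. The canonical system for \<open>I/2 + \<tau> X\<^sub>q\<close> becomes
  \<open>\<alpha>' = -iz\<tau> q exp(izs) \<beta>\<close>, \<open>\<beta>' = iz\<tau> cnj q exp(-izs) \<alpha>\<close>. On the free tail \<open>a\<close> grows and \<open>b\<close>
  decays exponentially, so \<open>Y\<close> is square-integrable iff \<open>\<alpha>(\<Lambda>) = 0\<close>, and for \<open>Y(0) = (1,m)\<close>
  the Schur transform of \<open>m\<close> is \<open>-\<alpha>(0)/\<beta>(0)\<close>. For small \<open>\<tau>\<close> the boundary value problem
  \<open>\<alpha>(\<Lambda>) = 0\<close>, \<open>\<beta>(0) = 1\<close> is a contraction, hence uniquely solvable, and its solution satisfies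
  \<open>\<alpha>(0) = iz\<tau> \<integral> q(s) exp(izs) ds + O(\<tau>\<^sup>3)\<close>.
\<close>

section \<open>Indefinite integrals\<close>

text \<open>These are the locally absolutely continuous functions in the sense of
  \<open>canonical_solution\<close>, with the derivative carried as an explicit representative that
  may be exchanged for any other one equal to it almost everywhere.\<close>

definition antiderivative :: "(real \<Rightarrow> 'a::euclidean_space) \<Rightarrow> (real \<Rightarrow> 'a) \<Rightarrow> bool" where
  "antiderivative f f' \<longleftrightarrow>
     (\<forall>t\<ge>0. f' absolutely_integrable_on {0..t} \<and> f t = f 0 + integral {0..t} f')"

lemma antiderivativeD:
  assumes "antiderivative f f'" "0 \<le> t"
  shows "f' absolutely_integrable_on {0..t}" "f' integrable_on {0..t}" "f t = f 0 + integral {0..t} f'"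
  using assms set_lebesgue_integral_eq_integral(1) unfolding antiderivative_def by blast+

lemma antiderivative_continuous_on:
  assumes "antiderivative f f'"
  shows "continuous_on {0..T} f"
proof (cases "0 \<le> T")
  case True
  have "continuous_on {0..T} (\<lambda>t. f 0 + integral {0..t} f')"
    by (intro continuous_intros indefinite_integral_continuous_1 antiderivativeD[OF assms True])
  then show ?thesis
    by (rule continuous_on_cong[THEN iffD1, rotated -1])
       (auto simp: antiderivativeD(3)[OF assms, symmetric])
qed auto

lemma antiderivative_linear:
  assumes "antiderivative f f'" "bounded_linear h"
  shows "antiderivative (\<lambda>t. h (f t)) (\<lambda>t. h (f' t))"
proof -
  interpret bounded_linear h by fact
  show ?thesis
    unfolding antiderivative_def
  proof (intro allI impI conjI)
    fix t :: real assume t: "0 \<le> t"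
    note D = antiderivativeD[OF assms(1) t]
    show "(\<lambda>t. h (f' t)) absolutely_integrable_on {0..t}"
      using absolutely_integrable_linear[OF D(1) assms(2)] by (simp add: o_def)
    show "h (f t) = h (f 0) + integral {0..t} (\<lambda>t. h (f' t))"
      using integral_linear[OF D(2) assms(2)] by (subst D(3)) (simp add: o_def add)
  qed
qed

lemma antiderivative_add:
  assumes "antiderivative f f'" "antiderivative g g'"
  shows "antiderivative (\<lambda>t. f t + g t) (\<lambda>t. f' t + g' t)"
  unfolding antiderivative_def
proof (intro allI impI conjI)
  fix t :: real assume t: "0 \<le> t"
  note f = antiderivativeD[OF assms(1) t] and g = antiderivativeD[OF assms(2) t]
  show "(\<lambda>t. f' t + g' t) absolutely_integrable_on {0..t}"
    by (intro set_integral_add(1) f g)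
  show "f t + g t = f 0 + g 0 + integral {0..t} (\<lambda>t. f' t + g' t)"
    by (subst f(3), subst g(3)) (simp add: integral_add f(2) g(2))
qed

text \<open>Integrals do not see null sets. This is what turns a differential equation valid only
  almost everywhere into an explicit formula for the derivative.\<close>

lemma antiderivative_cong_AE:
  assumes "antiderivative f f'" "AE s in lebesgue_on {0..}. f' s = g' s"
  shows "antiderivative f g'"
proof -
  have "AE s in lebesgue. s \<in> {0..} \<longrightarrow> f' s = g' s"
    using assms(2) by (subst (asm) AE_restrict_space_iff) auto
  then obtain N where N: "negligible N" "{s. \<not> (s \<in> {0..} \<longrightarrow> f' s = g' s)} \<subseteq> N"
    unfolding eventually_ae_filter_negligible by auto
  show ?thesis
    unfolding antiderivative_def
  proof (intro allI impI conjI)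
    fix t :: real assume t: "0 \<le> t"
    note D = antiderivativeD[OF assms(1) t]
    have eq: "f' s = g' s" if "s \<in> {0..t} - N" for s
      using that N(2) by auto
    show "g' absolutely_integrable_on {0..t}"
      using absolutely_integrable_spike[OF D(1) N(1)] eq by metis
    show "f t = f 0 + integral {0..t} g'"
      using D(3) integral_spike[OF N(1), of "{0..t}" g' f'] eq by metis
  qed
qed

lemma absolutely_integrable_continuous_mult:
  fixes f g :: "real \<Rightarrow> complex"
  assumes "continuous_on {a..b} f" "g absolutely_integrable_on {a..b}"
  shows "(\<lambda>x. f x * g x) absolutely_integrable_on {a..b}"
proof (rule absolutely_integrable_bounded_measurable_product[where h="(*)"])
  show "bilinear ((*) :: complex \<Rightarrow> complex \<Rightarrow> complex)"
    by (rule bilinear_times)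
  show "f \<in> borel_measurable (lebesgue_on {a..b})"
    by (intro continuous_imp_measurable_on_sets_lebesgue assms) auto
  show "bounded (f ` {a..b})"
    by (intro compact_imp_bounded compact_continuous_image assms) auto
qed (use assms in auto)

text \<open>
  With \<open>G(t)\<close> the integral of \<open>|g'|\<close>, the difference \<open>D\<close> of the two sides satisfies
  \<open>|D t - D s| \<le> 2 M |t - s| |G t - G s|\<close>. Since \<open>G\<close> is continuous, \<open>D\<close> has derivative zero
  everywhere, although \<open>g\<close> itself need not be differentiable.
\<close>

lemma antiderivative_mult_smooth:
  fixes e e' g g' :: "real \<Rightarrow> complex"
  assumes e: "\<And>t. (e has_vector_derivative e' t) (at t)" and e': "continuous_on UNIV e'"
    and g: "antiderivative g g'"
  shows "antiderivative (\<lambda>t. e t * g t) (\<lambda>t. e' t * g t + e t * g' t)"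
  unfolding antiderivative_def
proof (intro allI impI conjI)
  fix T :: real assume T: "0 \<le> T"
  let ?h = "\<lambda>t. e' t * g t + e t * g' t"
  have ce: "continuous_on A e" for A
    using e by (meson continuous_at_imp_continuous_on has_vector_derivative_continuous)
  have ce': "continuous_on A e'" for A
    using e' continuous_on_subset by blast
  have cg: "continuous_on A g" if "A \<subseteq> {0..T}" for A
    using antiderivative_continuous_on[OF g] that continuous_on_subset by blast
  have g'T: "g' absolutely_integrable_on {0..T}"
    using antiderivativeD(1)[OF g T] .
  have ai: "?h absolutely_integrable_on {0..T}"
    by (intro set_integral_add(1) absolutely_integrable_continuous_mult ce g'T
        absolutely_integrable_continuous_real continuous_on_mult ce' cg) auto
  then show "?h absolutely_integrable_on {0..T}" .
  have sub: "f absolutely_integrable_on {s..t}" "f integrable_on {s..t}"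
    if "f absolutely_integrable_on {0..T}" "0 \<le> s" "t \<le> T" for f :: "real \<Rightarrow> complex" and s t
    using absolutely_integrable_on_subinterval[OF that(1), of s t] that
    by (auto simp: absolutely_integrable_on_def)
  have intE: "integral {0..t} f - integral {0..s} f = integral {s..t} f"
    if "f absolutely_integrable_on {0..T}" "0 \<le> s" "s \<le> t" "t \<le> T"
    for f :: "real \<Rightarrow> complex" and s t
    using Henstock_Kurzweil_Integration.integral_combine[of 0 s t f] sub(2)[of f 0 t] that by (simp add: algebra_simps)
  define G where "G t = integral {0..t} (\<lambda>s. norm (g' s))" for t
  have ng': "(\<lambda>s. norm (g' s)) integrable_on {s..t}" if "0 \<le> s" "t \<le> T" for s t
    using sub(1)[OF g'T that] by (simp add: absolutely_integrable_on_def)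
  have GE: "G t - G s = integral {s..t} (\<lambda>s. norm (g' s))" if "0 \<le> s" "s \<le> t" "t \<le> T" for s t
    using Henstock_Kurzweil_Integration.integral_combine[of 0 s t "\<lambda>s. norm (g' s)"] ng'[of 0 t] that
    by (simp add: G_def algebra_simps)
  have Gmono: "G s \<le> G t" if "0 \<le> s" "s \<le> t" "t \<le> T" for s t
    using GE[OF that] integral_nonneg[OF ng'[of s t]] that by simp
  have Gcont: "continuous_on {0..T} G"
    unfolding G_def by (intro indefinite_integral_continuous_1 ng') auto
  obtain M where M: "M > 0" "\<And>t. t \<in> {0..T} \<Longrightarrow> norm (e' t) \<le> M"
    using compact_imp_bounded[OF compact_continuous_image[OF ce', of "{0..T}"]]
    by (auto simp: bounded_pos)
  have gdiff: "norm (g t - g s) \<le> G t - G s" if "0 \<le> s" "s \<le> t" "t \<le> T" for s t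
  proof -
    have "g t - g s = integral {s..t} g'"
      using antiderivativeD(3)[OF g, of t] antiderivativeD(3)[OF g, of s] intE[OF g'T that] that
      by simp
    also have "norm \<dots> \<le> integral {s..t} (\<lambda>s. norm (g' s))"
      using that by (intro integral_norm_bound_integral sub(2)[OF g'T] ng') auto
    finally show ?thesis using GE[OF that] by simp
  qed
  have ediff: "norm (e t - e s) \<le> M * (t - s)" if "0 \<le> s" "s \<le> t" "t \<le> T" for s t
  proof -
    have "norm (e t - e s) \<le> M * norm (t - s)"
    proof (rule differentiable_bound[where S="{0..T}" and f'="\<lambda>x h. h *\<^sub>R e' x"])
      show "(e has_derivative (\<lambda>h. h *\<^sub>R e' x)) (at x within {0..T})" for x
        using has_vector_derivative_at_within[OF e[of x]] by (simp add: has_vector_derivative_def)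
      show "onorm (\<lambda>h. h *\<^sub>R e' x) \<le> M" if "x \<in> {0..T}" for x
        using M(2)[OF that]
        by (intro onorm_le) (simp add: mult.commute[of "\<bar>_\<bar>"] mult_right_mono)
    qed (use that in auto)
    then show ?thesis using that by simp
  qed
  define D where "D t = e t * g t - integral {0..t} ?h" for t
  have Dle: "norm (D t - D s) \<le> 2 * M * (t - s) * (G t - G s)" if st: "0 \<le> s" "s \<le> t" "t \<le> T" for s t
  proof -
    have cl: "{s..t} \<subseteq> {0..T}" using st by auto
    have i1: "(\<lambda>u. e' u * (g s - g u)) integrable_on {s..t}"
      by (intro integrable_continuous_real continuous_intros ce' cg cl)
    have i2: "(\<lambda>u. (e t - e u) * g' u) integrable_on {s..t}"
      by (intro set_lebesgue_integral_eq_integral(1) absolutely_integrable_continuous_mult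
          sub(1)[OF g'T st(1,3)] continuous_intros ce)
    have i3: "(\<lambda>u. e t * g' u) integrable_on {s..t}"
      using sub(2)[OF g'T st(1,3)] by (intro integrable_on_mult_right)
    have i4: "(\<lambda>u. e' u * g s) integrable_on {s..t}"
      by (intro integrable_continuous_real continuous_intros ce')
    have "(e' has_integral e t - e s) {s..t}"
      using st by (intro fundamental_theorem_of_calculus has_vector_derivative_at_within[OF e])
    then have I4: "integral {s..t} (\<lambda>u. e' u * g s) = (e t - e s) * g s"
      by (intro integral_unique has_integral_mult_left)
    have "g t - g s = integral {s..t} g'"
      using antiderivativeD(3)[OF g, of t] antiderivativeD(3)[OF g, of s] intE[OF g'T st] st by simp
    then have I3: "integral {s..t} (\<lambda>u. e t * g' u) = e t * (g t - g s)"
      by simp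
    \<comment> \<open>Split \<open>e t * g t - e s * g s\<close> as
      \<open>e t * (g t - g s) + (e t - e s) * g s\<close> and write both increments as integrals.
      After subtracting \<open>?h\<close>, each term of the integrand is an increment of one factor
      times the derivative of the other, hence of second order.\<close>
    have "D t - D s = e t * g t - e s * g s - integral {s..t} ?h"
      unfolding intE[OF ai st, symmetric] by (simp add: D_def)
    also have "\<dots> = integral {s..t} (\<lambda>u. e t * g' u) + integral {s..t} (\<lambda>u. e' u * g s)
        - integral {s..t} ?h"
      unfolding I3 I4 by (simp add: algebra_simps)
    also have "\<dots> = integral {s..t} (\<lambda>u. e t * g' u + e' u * g s - ?h u)"
      by (simp add: integral_add integral_diff i3 i4 integrable_add sub(2)[OF ai st(1,3)])
    also have "\<dots> = integral {s..t} (\<lambda>u. (e t - e u) * g' u + e' u * (g s - g u))"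
      by (intro integral_cong) (simp add: algebra_simps)
    also have "norm \<dots> \<le> integral {s..t} (\<lambda>u. M * (t - s) * norm (g' u) + M * (G t - G s))"
    proof (intro integral_norm_bound_integral integrable_add i1 i2)
      show "(\<lambda>u. M * (t - s) * norm (g' u)) integrable_on {s..t}"
        by (intro integrable_on_mult_right ng' st)
      fix u assume u: "u \<in> {s..t}"
      have "norm (e t - e u) \<le> M * (t - u)" using u st by (intro ediff) auto
      also have "\<dots> \<le> M * (t - s)" using u M by auto
      finally have 1: "norm ((e t - e u) * g' u) \<le> M * (t - s) * norm (g' u)"
        by (simp add: norm_mult mult_right_mono)
      have "norm (g s - g u) \<le> G u - G s"
        using gdiff[of s u] u st by (simp add: norm_minus_commute)
      also have "\<dots> \<le> G t - G s" using Gmono[of u t] u st by simp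
      finally have "norm (g s - g u) \<le> G t - G s" .
      moreover have "norm (e' u) \<le> M" using u st by (intro M(2)) auto
      ultimately have 2: "norm (e' u * (g s - g u)) \<le> M * (G t - G s)"
        unfolding norm_mult using M(1) by (intro mult_mono) simp_all
      show "norm ((e t - e u) * g' u + e' u * (g s - g u))
          \<le> M * (t - s) * norm (g' u) + M * (G t - G s)"
        by (intro order_trans[OF norm_triangle_ineq] add_mono 1 2)
    qed auto
    also have "\<dots> = M * (t - s) * (G t - G s) + M * (G t - G s) * (t - s)"
    proof (rule integral_unique, rule has_integral_add)
      have "((\<lambda>u. norm (g' u)) has_integral G t - G s) {s..t}"
        unfolding GE[OF st] by (intro integrable_integral ng' st)
      then show "((\<lambda>u. M * (t - s) * norm (g' u)) has_integral M * (t - s) * (G t - G s)) {s..t}"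
        by (rule has_integral_mult_right)
      show "((\<lambda>u. M * (G t - G s)) has_integral M * (G t - G s) * (t - s)) {s..t}"
        using has_integral_const_real[of "M * (G t - G s)" s t] st by (simp add: mult.commute)
    qed
    finally show ?thesis by (simp add: algebra_simps)
  qed
  have Dle': "norm (D t - D s) \<le> 2 * M * \<bar>G t - G s\<bar> * norm (t - s)"
    if "s \<in> {0..T}" "t \<in> {0..T}" for s t
  proof (cases "s \<le> t")
    case True
    then have "\<bar>G t - G s\<bar> = G t - G s" "norm (t - s) = t - s"
      using Gmono[of s t] that by auto
    then show ?thesis using Dle[of s t] that True by (simp only: mult_ac) auto
  next
    case False
    then have "\<bar>G t - G s\<bar> = G s - G t" "norm (t - s) = s - t"
      using Gmono[of t s] that by auto
    then show ?thesis using Dle[of t s] that False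
      by (simp only: mult_ac norm_minus_commute[of "D t"]) auto
  qed
  have "(D has_derivative (\<lambda>h. 0)) (at s within {0..T})" if s: "s \<in> {0..T}" for s
    unfolding has_derivative_within
  proof (intro conjI bounded_linear_zero)
    have "((\<lambda>t. 2 * M * \<bar>G t - G s\<bar>) \<longlongrightarrow> 2 * M * \<bar>G s - G s\<bar>) (at s within {0..T})"
      using Gcont s by (intro tendsto_intros) (auto simp: continuous_on_def)
    then have lim: "((\<lambda>t. 2 * M * \<bar>G t - G s\<bar>) \<longlongrightarrow> 0) (at s within {0..T})" by simp
    show "((\<lambda>t. (1 / norm (t - s)) *\<^sub>R (D t - (D s + 0))) \<longlongrightarrow> 0) (at s within {0..T})"
    proof (rule Lim_null_comparison[OF _ lim])
      show "\<forall>\<^sub>F t in at s within {0..T}. norm ((1 / norm (t - s)) *\<^sub>R (D t - (D s + 0))) \<le> 2 * M * \<bar>G t - G s\<bar>"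
        unfolding eventually_at_filter
      proof (intro always_eventually allI impI)
        fix t assume "t \<noteq> s" "t \<in> {0..T}"
        then show "norm ((1 / norm (t - s)) *\<^sub>R (D t - (D s + 0))) \<le> 2 * M * \<bar>G t - G s\<bar>"
          using Dle'[OF s, of t] by (simp add: pos_divide_le_eq)
      qed
    qed
  qed
  then obtain c where c: "\<And>s. s \<in> {0..T} \<Longrightarrow> D s = c"
    using has_derivative_zero_constant[of "{0..T}" D] by (metis convex_real_interval(5))
  have "D T = D 0"
    using c[of 0] c[of T] T by simp
  then have "e T * g T - integral {0..T} ?h = e 0 * g 0"
    by (simp add: D_def)
  then show "e T * g T = e 0 * g 0 + integral {0..T} ?h"
    by (simp only: diff_eq_eq)
qed

section \<open>A two-point boundary value problem\<close>

lemma norm_integral_mult_le: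
  fixes f g :: "real \<Rightarrow> complex"
  assumes f: "f absolutely_integrable_on {a..b}" and g: "continuous_on {a..b} g"
    and M: "\<And>x. x \<in> {a..b} \<Longrightarrow> norm (g x) \<le> M" "0 \<le> M" and st: "a \<le> s" "t \<le> b"
  shows "norm (integral {s..t} (\<lambda>x. f x * g x)) \<le> integral {a..b} (\<lambda>x. norm (f x)) * M"
proof -
  have sub: "{s..t} \<subseteq> {a..b}" using st by auto
  have nf: "(\<lambda>x. norm (f x)) integrable_on {a..b}"
    using f by (simp add: absolutely_integrable_on_def)
  have nf': "(\<lambda>x. norm (f x)) integrable_on {s..t}"
    using nf sub by (rule integrable_on_subinterval)
  have "(\<lambda>x. g x * f x) absolutely_integrable_on {s..t}"
    by (intro absolutely_integrable_continuous_mult continuous_on_subset[OF g sub]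
        absolutely_integrable_on_subinterval[OF f sub])
  then have "(\<lambda>x. f x * g x) integrable_on {s..t}"
    by (simp add: absolutely_integrable_on_def mult.commute)
  then have "norm (integral {s..t} (\<lambda>x. f x * g x)) \<le> integral {s..t} (\<lambda>x. norm (f x) * M)"
    using sub M by (intro integral_norm_bound_integral integrable_on_mult_left nf')
      (auto simp: norm_mult intro!: mult_left_mono)
  also have "\<dots> = integral {s..t} (\<lambda>x. norm (f x)) * M" by simp
  also have "\<dots> \<le> integral {a..b} (\<lambda>x. norm (f x)) * M"
    using M(2) by (intro mult_right_mono integral_subset_le sub nf nf') auto
  finally show ?thesis .
qed

text \<open>Integral form of \<alpha>' = -P \<beta>, \<beta>' = R \<alpha> with \<alpha>(\<Lambda>)
  = 0 and \<beta>(0) = b. Integrating \<alpha> backwards from \<Lambda> builds the terminal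
  condition into the equation.\<close>

definition two_point_solution ::
  "real \<Rightarrow> (real \<Rightarrow> complex) \<Rightarrow> (real \<Rightarrow> complex) \<Rightarrow> complex \<Rightarrow>
   (real \<Rightarrow> complex) \<Rightarrow> (real \<Rightarrow> complex) \<Rightarrow> bool" where
  "two_point_solution \<Lambda> P R b \<alpha> \<beta> \<longleftrightarrow>
     continuous_on {0..\<Lambda>} \<alpha> \<and> continuous_on {0..\<Lambda>} \<beta> \<and>
     (\<forall>t\<in>{0..\<Lambda>}. \<alpha> t = integral {t..\<Lambda>} (\<lambda>s. P s * \<beta> s) \<and>
                  \<beta> t = b + integral {0..t} (\<lambda>s. R s * \<alpha> s))"

context
  fixes \<Lambda> :: real and P R :: "real \<Rightarrow> complex" and p r :: real
  assumes \<Lambda>: "0 \<le> \<Lambda>"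
    and P: "P absolutely_integrable_on {0..\<Lambda>}" and R: "R absolutely_integrable_on {0..\<Lambda>}"
  defines "p \<equiv> integral {0..\<Lambda>} (\<lambda>s. norm (P s))" and "r \<equiv> integral {0..\<Lambda>} (\<lambda>s. norm (R s))"
  assumes small: "p * r \<le> 1/2"
begin

private lemma pr_nonneg: "0 \<le> p" "0 \<le> r"
  using P R by (auto simp: p_def r_def absolutely_integrable_on_def intro!: integral_nonneg)

private lemma integrable_mult:
  fixes F g :: "real \<Rightarrow> complex"
  assumes "F absolutely_integrable_on {0..\<Lambda>}" "continuous_on {0..\<Lambda>} g" "0 \<le> s" "t \<le> \<Lambda>"
  shows "(\<lambda>x. F x * g x) integrable_on {s..t}"
proof -
  have "(\<lambda>x. g x * F x) absolutely_integrable_on {0..\<Lambda>}"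
    by (intro absolutely_integrable_continuous_mult assms)
  then have "(\<lambda>x. F x * g x) integrable_on {0..\<Lambda>}"
    by (simp add: absolutely_integrable_on_def mult.commute)
  then show ?thesis
    by (rule integrable_on_subinterval) (use assms in auto)
qed

text \<open>Absorption at a point \<open>u\<close> where the modulus of \<beta> is largest:
  |\<alpha>| is at most p |\<beta>(u)|, and inserting this in the equation for \<beta> gives
  |\<beta>(u) - b| \<le> p r |\<beta>(u)| \<le> |\<beta>(u)| / 2. The bounds vanish with
  \<open>b\<close>, which later yields uniqueness.\<close>

lemma two_point_solution_bound:
  assumes "two_point_solution \<Lambda> P R b \<alpha> \<beta>" "t \<in> {0..\<Lambda>}"
  shows "norm (\<beta> t) \<le> 2 * norm b" "norm (\<alpha> t) \<le> p * (2 * norm b)"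
proof -
  note D = assms(1)[unfolded two_point_solution_def]
  obtain u where u: "u \<in> {0..\<Lambda>}" "\<And>t. t \<in> {0..\<Lambda>} \<Longrightarrow> norm (\<beta> t) \<le> norm (\<beta> u)"
    using continuous_attains_sup[of "{0..\<Lambda>}" "\<lambda>t. norm (\<beta> t)"] D \<Lambda>
      continuous_on_norm[of "{0..\<Lambda>}" \<beta>]
    by (metis atLeastatMost_empty_iff2 compact_Icc not_le)
  have \<alpha>: "norm (\<alpha> t) \<le> p * norm (\<beta> u)" if t: "t \<in> {0..\<Lambda>}" for t
  proof -
    have "norm (integral {t..\<Lambda>} (\<lambda>s. P s * \<beta> s)) \<le> p * norm (\<beta> u)"
      unfolding p_def using t u D by (intro norm_integral_mult_le P) auto
    then show ?thesis using D t by metis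
  qed
  have "norm (integral {0..u} (\<lambda>s. R s * \<alpha> s)) \<le> r * (p * norm (\<beta> u))"
    unfolding r_def using u D \<alpha> pr_nonneg by (intro norm_integral_mult_le R) auto
  also have "\<dots> = p * r * norm (\<beta> u)" by simp
  also have "\<dots> \<le> 1/2 * norm (\<beta> u)" by (intro mult_right_mono small) auto
  finally have "norm (\<beta> u - b) \<le> norm (\<beta> u) / 2"
    using D u by (metis add_diff_cancel_left' mult.commute mult.right_neutral times_divide_eq_right)
  moreover have "norm (\<beta> u) \<le> norm b + norm (\<beta> u - b)"
    using norm_triangle_ineq[of b "\<beta> u - b"] by simp
  ultimately have \<beta>u: "norm (\<beta> u) \<le> 2 * norm b" by linarith
  then show "norm (\<beta> t) \<le> 2 * norm b" using u(2)[OF assms(2)] by linarith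
  show "norm (\<alpha> t) \<le> p * (2 * norm b)"
    using \<alpha>[OF assms(2)] mult_left_mono[OF \<beta>u pr_nonneg(1)] by linarith
qed

text \<open>First Born approximation: \<beta> is replaced by its initial value in \<alpha>(0) =
  \<integral> P \<beta>, and the a priori bound on \<alpha> controls \<beta> - b. The error carries
  the factors p, r, p and so is cubic once P and R are proportional to a small parameter.\<close>

lemma two_point_solution_approx:
  assumes "two_point_solution \<Lambda> P R b \<alpha> \<beta>"
  shows "norm (\<alpha> 0 - b * integral {0..\<Lambda>} P) \<le> p * (r * (p * (2 * norm b)))"
proof -
  note D = assms[unfolded two_point_solution_def]
  have \<beta>: "norm (\<beta> t - b) \<le> r * (p * (2 * norm b))" if t: "t \<in> {0..\<Lambda>}" for t
  proof -
    have "norm (integral {0..t} (\<lambda>s. R s * \<alpha> s)) \<le> r * (p * (2 * norm b))"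
      unfolding r_def using t D two_point_solution_bound(2)[OF assms] pr_nonneg
      by (intro norm_integral_mult_le R) auto
    moreover have "\<beta> t - b = integral {0..t} (\<lambda>s. R s * \<alpha> s)" using D t by auto
    ultimately show ?thesis by simp
  qed
  have "integral {0..\<Lambda>} (\<lambda>s. P s * (\<beta> s - b)) =
      integral {0..\<Lambda>} (\<lambda>s. P s * \<beta> s) - integral {0..\<Lambda>} (\<lambda>s. P s * b)"
    using D unfolding right_diff_distrib
    by (intro integral_diff integrable_mult P) auto
  also have "\<dots> = \<alpha> 0 - b * integral {0..\<Lambda>} P"
    using D \<Lambda> by (simp add: mult.commute)
  finally have "\<alpha> 0 - b * integral {0..\<Lambda>} P = integral {0..\<Lambda>} (\<lambda>s. P s * (\<beta> s - b))" ..
  also have "norm \<dots> \<le> p * (r * (p * (2 * norm b)))"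
    unfolding p_def
    by (intro norm_integral_mult_le P \<beta>[unfolded p_def])
       (use D pr_nonneg in \<open>auto intro!: continuous_intros simp: p_def\<close>)
  finally show ?thesis .
qed

lemma two_point_solution_diff:
  assumes "two_point_solution \<Lambda> P R b \<alpha> \<beta>" "two_point_solution \<Lambda> P R b' \<alpha>' \<beta>'"
  shows "two_point_solution \<Lambda> P R (b - c * b') (\<lambda>t. \<alpha> t - c * \<alpha>' t) (\<lambda>t. \<beta> t - c * \<beta>' t)"
proof -
  note D = assms(1)[unfolded two_point_solution_def] and E = assms(2)[unfolded two_point_solution_def]
  have I: "integral {s..t} (\<lambda>x. F x * (g x - c * h x)) =
      integral {s..t} (\<lambda>x. F x * g x) - c * integral {s..t} (\<lambda>x. F x * h x)"
    if "F absolutely_integrable_on {0..\<Lambda>}" "continuous_on {0..\<Lambda>} g" "continuous_on {0..\<Lambda>} h"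
      "0 \<le> s" "t \<le> \<Lambda>" for F g h s t
  proof -
    have "integral {s..t} (\<lambda>x. F x * (g x - c * h x)) = integral {s..t} (\<lambda>x. F x * g x - c * (F x * h x))"
      by (simp add: algebra_simps)
    also have "\<dots> = integral {s..t} (\<lambda>x. F x * g x) - integral {s..t} (\<lambda>x. c * (F x * h x))"
      by (intro integral_diff integrable_on_mult_right integrable_mult that)
    finally show ?thesis by simp
  qed
  show ?thesis
    unfolding two_point_solution_def
  proof (intro conjI ballI)
    fix t assume t: "t \<in> {0..\<Lambda>}"
    then have "\<alpha> t - c * \<alpha>' t = integral {t..\<Lambda>} (\<lambda>s. P s * \<beta> s) - c * integral {t..\<Lambda>} (\<lambda>s. P s * \<beta>' s)"
      and "\<beta> t - c * \<beta>' t = (b + integral {0..t} (\<lambda>s. R s * \<alpha> s)) - c * (b' + integral {0..t} (\<lambda>s. R s * \<alpha>' s))"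
      using D E by metis+
    moreover have "integral {t..\<Lambda>} (\<lambda>s. P s * (\<beta> s - c * \<beta>' s)) =
        integral {t..\<Lambda>} (\<lambda>s. P s * \<beta> s) - c * integral {t..\<Lambda>} (\<lambda>s. P s * \<beta>' s)"
      and "integral {0..t} (\<lambda>s. R s * (\<alpha> s - c * \<alpha>' s)) =
        integral {0..t} (\<lambda>s. R s * \<alpha> s) - c * integral {0..t} (\<lambda>s. R s * \<alpha>' s)"
      using t D E by (intro I P R; simp)+
    ultimately show "\<alpha> t - c * \<alpha>' t = integral {t..\<Lambda>} (\<lambda>s. P s * (\<beta> s - c * \<beta>' s))"
      "\<beta> t - c * \<beta>' t = b - c * b' + integral {0..t} (\<lambda>s. R s * (\<alpha> s - c * \<alpha>' s))"
      by (simp_all only:) (simp add: distrib_left)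
  qed (use D E in \<open>auto intro!: continuous_intros\<close>)
qed

text \<open>The combination \<open>\<alpha> t - b * A t\<close> belongs to a solution with datum
  \<open>b - b * 1\<close>, that is 0, for which the a priori bound is zero.\<close>

lemma two_point_solution_unique:
  assumes "two_point_solution \<Lambda> P R b \<alpha> \<beta>" "two_point_solution \<Lambda> P R 1 A B" "t \<in> {0..\<Lambda>}"
  shows "\<alpha> t = b * A t"
  using two_point_solution_bound(2)[OF two_point_solution_diff[OF assms(1,2), of b] assms(3)] by simp

text \<open>Banach's fixed point theorem for \<beta> alone: \<open>\<alpha> x\<close> is computed
  from \<open>x\<close> by the first equation and inserted in the second, and the resulting map
  contracts by p r \<le> 1/2 in the supremum norm.\<close>

lemma two_point_solution_exists: "\<exists>\<alpha> \<beta>. two_point_solution \<Lambda> P R 1 \<alpha> \<beta>"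
proof -
  define \<alpha> where "\<alpha> x t = integral {t..\<Lambda>} (\<lambda>s. P s * apply_bcontfun x s)" for x :: "real \<Rightarrow>\<^sub>C complex" and t
  define F where "F x t = 1 + integral {0..t} (\<lambda>s. R s * \<alpha> x s)" for x t
  have c\<alpha>: "continuous_on {0..\<Lambda>} (\<alpha> x)" for x
    unfolding \<alpha>_def by (intro indefinite_integral_continuous_1' integrable_mult P) auto
  have cF: "continuous_on (cbox 0 \<Lambda>) (F x)" for x
    unfolding F_def cbox_interval
    by (intro continuous_intros indefinite_integral_continuous_1 integrable_mult R c\<alpha>) auto
  \<comment> \<open>The complete space used consists of bounded continuous functions on the whole
    line, so \<open>F x\<close> is continued past the interval by its endpoint values through
    \<open>clamp\<close>. Distances between images are then controlled on the interval
    alone.\<close>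
  have "\<exists>g :: real \<Rightarrow>\<^sub>C complex. (\<forall>t\<in>cbox 0 \<Lambda>. g t = F x t) \<and> (\<forall>t. g t = F x (clamp 0 \<Lambda> t))" for x
    by (rule continuous_on_cbox_bcontfunE[OF cF[of x]]) blast
  then obtain U :: "(real \<Rightarrow>\<^sub>C complex) \<Rightarrow> (real \<Rightarrow>\<^sub>C complex)"
    where U: "\<And>x t. t \<in> cbox 0 \<Lambda> \<Longrightarrow> U x t = F x t" "\<And>x t. U x t = F x (clamp 0 \<Lambda> t)"
    by metis
  have F_le: "norm (F x t - F y t) \<le> 1/2 * dist x y" if t: "t \<in> {0..\<Lambda>}" for x y t
  proof -
    have \<alpha>_le: "norm (\<alpha> x s - \<alpha> y s) \<le> p * dist x y" if "s \<in> {0..\<Lambda>}" for s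
    proof -
      have "\<alpha> x s - \<alpha> y s = integral {s..\<Lambda>} (\<lambda>s. P s * (x s - y s))"
        unfolding \<alpha>_def right_diff_distrib using that
        by (intro integral_diff[symmetric] integrable_mult P) auto
      also have "norm \<dots> \<le> p * dist x y"
        unfolding p_def using that dist_bounded[of x _ y]
        by (intro norm_integral_mult_le P) (auto intro!: continuous_intros simp: dist_norm)
      finally show ?thesis .
    qed
    have "F x t - F y t = integral {0..t} (\<lambda>s. R s * \<alpha> x s) - integral {0..t} (\<lambda>s. R s * \<alpha> y s)"
      unfolding F_def by simp
    also have "\<dots> = integral {0..t} (\<lambda>s. R s * (\<alpha> x s - \<alpha> y s))"
      unfolding right_diff_distrib using t
      by (intro integral_diff[symmetric] integrable_mult R c\<alpha>) auto
    also have "norm \<dots> \<le> r * (p * dist x y)"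
      unfolding r_def using t \<alpha>_le pr_nonneg
      by (intro norm_integral_mult_le R) (auto intro!: continuous_intros c\<alpha>)
    also have "\<dots> = (p * r) * dist x y" by simp
    also have "\<dots> \<le> 1/2 * dist x y" by (intro mult_right_mono small) auto
    finally show ?thesis .
  qed
  have "dist (U x) (U y) \<le> 1/2 * dist x y" for x y
  proof (rule dist_bound)
    fix t
    have "clamp 0 \<Lambda> t \<in> {0..\<Lambda>}"
      using clamp_in_interval[of 0 \<Lambda> t] \<Lambda> by simp
    then show "dist (U x t) (U y t) \<le> 1/2 * dist x y"
      using F_le U(2) by (simp add: dist_norm)
  qed
  then obtain x where x: "U x = x"
    using banach_fix_type[of "1/2" U] by auto
  have "two_point_solution \<Lambda> P R 1 (\<alpha> x) (apply_bcontfun x)"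
    unfolding two_point_solution_def
    using c\<alpha>[of x] U(1)[of _ x] x by (auto simp: \<alpha>_def F_def)
  then show ?thesis by blast
qed

end

section \<open>The canonical system in rescaled coordinates\<close>

lemma antiderivative_exp_mult:
  assumes "antiderivative g g'"
  shows "antiderivative (\<lambda>t. exp (c * complex_of_real t) * g t)
    (\<lambda>t. c * exp (c * complex_of_real t) * g t + exp (c * complex_of_real t) * g' t)"
proof (rule antiderivative_mult_smooth[OF _ _ assms])
  fix t :: real
  have "((\<lambda>w. exp (c * w)) has_field_derivative c * exp (c * complex_of_real t)) (at (complex_of_real t))"
    by (auto intro!: derivative_eq_intros)
  then show "((\<lambda>t. exp (c * complex_of_real t)) has_vector_derivative c * exp (c * complex_of_real t)) (at t)"
    by (rule has_vector_derivative_real_field)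
qed (intro continuous_intros)

text \<open>\<open>J_mat\<close> acts on this coordinate as multiplication by \<open>\<i>\<close>
  and on \<open>minus_coord\<close> as multiplication by \<open>- \<i>\<close>, so together they
  diagonalise the free system.\<close>

definition plus_coord :: "complex^2 \<Rightarrow> complex" where
  "plus_coord y = y$1 + \<i> * y$2"

definition minus_coord :: "complex^2 \<Rightarrow> complex" where
  "minus_coord y = y$1 - \<i> * y$2"

lemma bounded_linear_plus_coord: "bounded_linear plus_coord"
  unfolding plus_coord_def
  by (intro bounded_linear_add bounded_linear_vec_nth bounded_linear_const_mult)

lemma bounded_linear_minus_coord: "bounded_linear minus_coord"
  unfolding minus_coord_def
  by (intro bounded_linear_sub bounded_linear_vec_nth bounded_linear_const_mult)

lemma coords_eq_iff: "y = y' \<longleftrightarrow> plus_coord y = plus_coord y' \<and> minus_coord y = minus_coord y'"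
proof
  assume *: "plus_coord y = plus_coord y' \<and> minus_coord y = minus_coord y'"
  then have "y$1 + \<i> * y$2 = y'$1 + \<i> * y'$2" "y$1 - \<i> * y$2 = y'$1 - \<i> * y'$2"
    by (simp_all add: plus_coord_def minus_coord_def)
  then have "2 * y$1 = 2 * y'$1" "2 * \<i> * y$2 = 2 * \<i> * y'$2" by algebra+
  then show "y = y'" by (simp add: vec_eq_iff forall_2)
qed auto

definition from_coords :: "complex \<Rightarrow> complex \<Rightarrow> complex^2" where
  "from_coords a b = vector [(a + b) / 2, (a - b) / (2 * \<i>)]"

lemma plus_coord_from_coords [simp]: "plus_coord (from_coords a b) = a"
  by (simp add: plus_coord_def from_coords_def field_simps)

lemma minus_coord_from_coords [simp]: "minus_coord (from_coords a b) = b"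
  by (simp add: minus_coord_def from_coords_def field_simps)

lemma from_coords_coords [simp]: "from_coords (plus_coord y) (minus_coord y) = y"
  by (simp add: coords_eq_iff)

lemma antiderivative_from_coords:
  assumes "antiderivative a a'" "antiderivative b b'"
  shows "antiderivative (\<lambda>t. from_coords (a t) (b t)) (\<lambda>t. from_coords (a' t) (b' t))"
proof -
  have eq: "from_coords v w = from_coords v 0 + from_coords 0 w" for v w
    by (simp add: from_coords_def vec_eq_iff forall_2 field_simps)
  have "linear (\<lambda>w. from_coords w 0)" "linear (\<lambda>w. from_coords 0 w)"
    by (auto intro!: linearI simp: from_coords_def vec_eq_iff forall_2 add_divide_distrib
        distrib_left scaleR_conv_of_real[of _ "_ :: complex"])
  then have "bounded_linear (\<lambda>w. from_coords w 0)" "bounded_linear (\<lambda>w. from_coords 0 w)"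
    by (simp_all add: linear_conv_bounded_linear)
  from antiderivative_add[OF antiderivative_linear[OF assms(1) this(1)]
      antiderivative_linear[OF assms(2) this(2)]]
  show ?thesis by (simp flip: eq)
qed

text \<open>The symmetric trace-free matrix \<open>X_mat w\<close> is antidiagonal in these
  coordinates: it sends the pair (a, b) to (w b, cnj w a). Hence the free part produces the diagonal
  terms and the perturbation only the coupling.\<close>

lemma canonical_equation_coords:
  "J_mat *v y' = z *s (map_matrix complex_of_real (mat (1/2) + \<tau> *\<^sub>R X_mat w) *v y) \<longleftrightarrow>
     plus_coord y' = - (\<i> * z / 2) * plus_coord y - \<i> * z * \<tau> * w * minus_coord y \<and>
     minus_coord y' = \<i> * z / 2 * minus_coord y + \<i> * z * \<tau> * cnj w * plus_coord y"
    (is "?L \<longleftrightarrow> ?R")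
proof -
  have w: "w = of_real (Re w) + \<i> * of_real (Im w)" "cnj w = of_real (Re w) - \<i> * of_real (Im w)"
    by (simp_all add: complex_eq_iff)
  let ?u = "complex_of_real (Re w)" and ?v = "complex_of_real (Im w)"
  let ?k1 = "z * (y$1 / 2 + \<tau> * (?u * y$1 + ?v * y$2))"
  let ?k2 = "z * (y$2 / 2 + \<tau> * (?v * y$1 - ?u * y$2))"
  have vec: "- (y'$2) = k1 \<and> y'$1 = k2 \<longleftrightarrow> y' = vector [k2, - k1]" for k1 k2
    by (auto simp: vec_eq_iff forall_2)
  have "?L \<longleftrightarrow> - (y'$2) = ?k1 \<and> y'$1 = ?k2"
    by (simp add: vec_eq_iff forall_2 J_mat_def X_mat_def matrix_vector_mult_def sum_2 mat_def
        map_matrix_def algebra_simps)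
  also have "\<dots> \<longleftrightarrow> y' = vector [?k2, - ?k1]"
    by (rule vec)
  also have "\<dots> \<longleftrightarrow> plus_coord y' = ?k2 + \<i> * (- ?k1) \<and> minus_coord y' = ?k2 - \<i> * (- ?k1)"
    by (subst coords_eq_iff) (simp add: plus_coord_def minus_coord_def)
  also have "?k2 + \<i> * (- ?k1) = - (\<i> * z / 2) * plus_coord y - \<i> * z * \<tau> * w * minus_coord y"
    unfolding plus_coord_def minus_coord_def by (subst w(1)) (simp add: field_simps)
  also have "?k2 - \<i> * (- ?k1) = \<i> * z / 2 * minus_coord y + \<i> * z * \<tau> * cnj w * plus_coord y"
    unfolding plus_coord_def minus_coord_def by (subst w(2)) (simp add: field_simps)
  finally show ?thesis .
qed

text \<open>The exponentials are integrating factors for the diagonal terms, so only the coupling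
  survives. The existentially quantified derivative of \<open>canonical_solution\<close> gives way
  to explicit ones, which makes the system a pair of integral equations.\<close>

lemma canonical_solution_iff:
  fixes Y :: "real \<Rightarrow> complex^2" and Q :: "real \<Rightarrow> complex" and \<tau> :: real and z :: complex
  assumes H: "\<And>s. 0 \<le> s \<Longrightarrow> H s = mat (1/2) + \<tau> *\<^sub>R X_mat (Q s)"
  defines "\<alpha> \<equiv> \<lambda>t. exp (\<i> * z / 2 * of_real t) * plus_coord (Y t)"
    and "\<beta> \<equiv> \<lambda>t. exp (- (\<i> * z / 2) * of_real t) * minus_coord (Y t)"
  shows "canonical_solution H z Y \<longleftrightarrow>
    antiderivative \<alpha> (\<lambda>s. - (\<i> * z * \<tau> * Q s * exp (\<i> * z * of_real s)) * \<beta> s) \<and>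
    antiderivative \<beta> (\<lambda>s. \<i> * z * \<tau> * cnj (Q s) * exp (- (\<i> * z) * of_real s) * \<alpha> s)"
    (is "_ \<longleftrightarrow> antiderivative _ ?\<alpha>' \<and> antiderivative _ ?\<beta>'")
proof
  let ?c = "\<i> * z / 2"
  have ee: "exp (\<i> * z * of_real s) = exp (?c * of_real s) * exp (?c * of_real s)"
    "exp (- (\<i> * z) * of_real s) = exp (- ?c * of_real s) * exp (- ?c * of_real s)"
    "exp (?c * of_real s) * exp (- ?c * of_real s) = 1"
    "exp (- ?c * of_real s) * exp (?c * of_real s) = 1" for s
    by (simp_all flip: exp_add add: mult.assoc)
  have \<alpha>': "?\<alpha>' s = - \<i> * z * \<tau> * Q s * exp (?c * of_real s) * minus_coord (Y s)" for s
    unfolding \<beta>_def ee(1) using ee(3)[of s] by algebra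
  have \<beta>': "?\<beta>' s = \<i> * z * \<tau> * cnj (Q s) * exp (- ?c * of_real s) * plus_coord (Y s)" for s
    unfolding \<alpha>_def ee(2) using ee(3)[of s] by algebra
  {
    assume "canonical_solution H z Y"
    then obtain Y' where Y': "antiderivative Y Y'"
      and eq: "AE s in lebesgue_on {0..}.
              J_mat *v Y' s = z *s (map_matrix complex_of_real (H s) *v Y s)"
      unfolding canonical_solution_def antiderivative_def by blast
    have "AE s in lebesgue_on {0::real..}. s \<in> {0..}"
      by (rule AE_I2) simp
    with eq have eq': "AE s in lebesgue_on {0..}.
        plus_coord (Y' s) = - ?c * plus_coord (Y s) - \<i> * z * \<tau> * Q s * minus_coord (Y s) \<and>
        minus_coord (Y' s) = ?c * minus_coord (Y s) + \<i> * z * \<tau> * cnj (Q s) * plus_coord (Y s)"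
      by eventually_elim (simp only: H atLeast_iff canonical_equation_coords)
    show "antiderivative \<alpha> ?\<alpha>' \<and> antiderivative \<beta> ?\<beta>'"
    proof
      show "antiderivative \<alpha> ?\<alpha>'"
        unfolding \<alpha>_def
      proof (rule antiderivative_cong_AE[OF
            antiderivative_exp_mult[OF antiderivative_linear[OF Y' bounded_linear_plus_coord], of ?c]])
        show "AE s in lebesgue_on {0..}. ?c * exp (?c * of_real s) * plus_coord (Y s) +
            exp (?c * of_real s) * plus_coord (Y' s) = ?\<alpha>' s"
          using eq' by eventually_elim (simp only: \<alpha>', simp add: algebra_simps)
      qed
      show "antiderivative \<beta> ?\<beta>'"
        unfolding \<beta>_def
      proof (rule antiderivative_cong_AE[OF
            antiderivative_exp_mult[OF antiderivative_linear[OF Y' bounded_linear_minus_coord], of "- ?c"]])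
        show "AE s in lebesgue_on {0..}. - ?c * exp (- ?c * of_real s) * minus_coord (Y s) +
            exp (- ?c * of_real s) * minus_coord (Y' s) = ?\<beta>' s"
          using eq' by eventually_elim (simp only: \<beta>', simp add: algebra_simps)
      qed
    qed
  }
  assume *: "antiderivative \<alpha> ?\<alpha>' \<and> antiderivative \<beta> ?\<beta>'"
  have Ypos: "exp (- ?c * of_real t) * \<alpha> t = plus_coord (Y t)"
    and Yneg: "exp (?c * of_real t) * \<beta> t = minus_coord (Y t)" for t
    unfolding \<alpha>_def \<beta>_def using ee(3,4)[of t] by algebra+
  \<comment> \<open>The product rule applied to the inverse transformation. This representative of
    the derivative satisfies the equation at every \<open>s\<close> with
    \<open>0 \<le> s\<close>.\<close>
  let ?Y' = "\<lambda>t. from_coords (- ?c * exp (- ?c * of_real t) * \<alpha> t + exp (- ?c * of_real t) * ?\<alpha>' t)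
      (?c * exp (?c * of_real t) * \<beta> t + exp (?c * of_real t) * ?\<beta>' t)"
  have "antiderivative (\<lambda>t. from_coords (plus_coord (Y t)) (minus_coord (Y t))) ?Y'"
    unfolding Ypos[symmetric] Yneg[symmetric]
    by (intro antiderivative_from_coords antiderivative_exp_mult) (use * in auto)
  then have "antiderivative Y ?Y'" by simp
  moreover have "J_mat *v ?Y' s = z *s (map_matrix complex_of_real (H s) *v Y s)" if "0 \<le> s" for s
    unfolding H[OF that] canonical_equation_coords plus_coord_from_coords minus_coord_from_coords
  proof
    have "- ?c * exp (- ?c * of_real s) * \<alpha> s + exp (- ?c * of_real s) * ?\<alpha>' s =
        - ?c * (exp (- ?c * of_real s) * \<alpha> s) +
        (exp (- ?c * of_real s) * exp (?c * of_real s)) * (- \<i> * z * \<tau> * Q s * minus_coord (Y s))"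
      unfolding \<alpha>' by (simp only: mult_ac)
    then show "- ?c * exp (- ?c * of_real s) * \<alpha> s + exp (- ?c * of_real s) * ?\<alpha>' s =
        - ?c * plus_coord (Y s) - \<i> * z * \<tau> * Q s * minus_coord (Y s)"
      unfolding Ypos ee(4) by simp
    have "?c * exp (?c * of_real s) * \<beta> s + exp (?c * of_real s) * ?\<beta>' s =
        ?c * (exp (?c * of_real s) * \<beta> s) +
        (exp (?c * of_real s) * exp (- ?c * of_real s)) * (\<i> * z * \<tau> * cnj (Q s) * plus_coord (Y s))"
      unfolding \<beta>' by (simp only: mult_ac)
    then show "?c * exp (?c * of_real s) * \<beta> s + exp (?c * of_real s) * ?\<beta>' s =
        ?c * minus_coord (Y s) + \<i> * z * \<tau> * cnj (Q s) * plus_coord (Y s)"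
      unfolding Yneg ee(3) by simp
  qed
  then have "AE s in lebesgue_on {0..}. J_mat *v ?Y' s = z *s (map_matrix complex_of_real (H s) *v Y s)"
    by (intro AE_I2) simp
  ultimately show "canonical_solution H z Y"
    unfolding canonical_solution_def antiderivative_def by blast
qed

section \<open>Square-integrability on the free tail\<close>

lemma antiderivative_constant_tail:
  assumes "antiderivative f f'" "\<And>s. \<Lambda> \<le> s \<Longrightarrow> f' s = 0" "0 \<le> \<Lambda>" "\<Lambda> \<le> t"
  shows "f t = f \<Lambda>"
proof -
  have t: "0 \<le> t" using assms by simp
  have "integral {0..\<Lambda>} f' + integral {\<Lambda>..t} f' = integral {0..t} f'"
    using assms t by (intro Henstock_Kurzweil_Integration.integral_combine antiderivativeD[OF assms(1)])
  moreover have "integral {\<Lambda>..t} f' = 0"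
    using integral_cong[of "{\<Lambda>..t}" f' "\<lambda>_. 0"] assms(2) by simp
  ultimately show ?thesis
    using antiderivativeD(3)[OF assms(1) t] antiderivativeD(3)[OF assms(1,3)] by simp
qed

lemma antiderivative_extend_constant:
  fixes f f' :: "real \<Rightarrow> 'a::euclidean_space"
  assumes \<Lambda>: "0 \<le> \<Lambda>" and f': "f' absolutely_integrable_on {0..\<Lambda>}"
    and f: "\<And>t. t \<in> {0..\<Lambda>} \<Longrightarrow> f t = f 0 + integral {0..t} f'"
    and tail: "\<And>s. \<Lambda> \<le> s \<Longrightarrow> f' s = 0" "\<And>s. \<Lambda> \<le> s \<Longrightarrow> f s = f \<Lambda>"
  shows "antiderivative f f'"
  unfolding antiderivative_def
proof (intro allI impI)
  fix t :: real assume t: "0 \<le> t"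
  show "f' absolutely_integrable_on {0..t} \<and> f t = f 0 + integral {0..t} f'"
  proof (cases "t \<le> \<Lambda>")
    case True
    then show ?thesis
      using absolutely_integrable_on_subinterval[OF f', of 0 t] f[of t] t by simp
  next
    case False
    then have un: "{0..t} = {0..\<Lambda>} \<union> {\<Lambda>..t}" using \<Lambda> by auto
    have "(\<lambda>_. 0 :: 'a) absolutely_integrable_on {\<Lambda>..t}" by simp
    then have "f' absolutely_integrable_on {\<Lambda>..t}"
      by (rule absolutely_integrable_spike[where S="{}"]) (auto simp: tail)
    then have ai: "f' absolutely_integrable_on {0..t}"
      unfolding un by (intro set_integrable_Un f') auto
    have "integral {0..\<Lambda>} f' + integral {\<Lambda>..t} f' = integral {0..t} f'"
      using False \<Lambda> ai
      by (intro Henstock_Kurzweil_Integration.integral_combine) (auto simp: absolutely_integrable_on_def)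
    moreover have "integral {\<Lambda>..t} f' = 0"
      using integral_cong[of "{\<Lambda>..t}" f' "\<lambda>_. 0"] tail(1) by simp
    ultimately have "integral {0..t} f' = integral {0..\<Lambda>} f'" by simp
    moreover have "f t = f \<Lambda>" using tail(2)[of t] False by simp
    moreover have "f \<Lambda> = f 0 + integral {0..\<Lambda>} f'" using f[of \<Lambda>] \<Lambda> by simp
    ultimately show ?thesis using ai by simp
  qed
qed

text \<open>Arranged with \<open>Re w\<close> and \<open>Im w\<close> as last factors: for
  continuous \<open>Y\<close> their coefficients are continuous, so integrability of the energy
  follows from that of the potential.\<close>

lemma energy_density_perturbed:
  assumes "H s = mat (1/2) + \<tau> *\<^sub>R X_mat w"
  shows "energy_density H Y s =
      (cnj (Y s $ 1) * Y s $ 1 + cnj (Y s $ 2) * Y s $ 2) / 2 +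
      (of_real \<tau> * (cnj (Y s $ 1) * Y s $ 1 - cnj (Y s $ 2) * Y s $ 2)) * of_real (Re w) +
      (of_real \<tau> * (cnj (Y s $ 1) * Y s $ 2 + cnj (Y s $ 2) * Y s $ 1)) * of_real (Im w)"
  by (simp add: energy_density_def assms X_mat_def matrix_vector_mult_def sum_2 mat_def
        map_matrix_def field_simps)

text \<open>The parallelogram law: the squared moduli of Y1 + i Y2 and Y1 - i Y2 add up to twice
  those of Y1 and Y2.\<close>

lemma energy_density_free:
  assumes "H s = mat (1/2)"
  shows "energy_density H Y s =
    of_real (((norm (plus_coord (Y s)))\<^sup>2 + (norm (minus_coord (Y s)))\<^sup>2) / 4)"
proof -
  have "energy_density H Y s = (cnj (Y s $ 1) * Y s $ 1 + cnj (Y s $ 2) * Y s $ 2) / 2"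
    by (simp add: energy_density_def assms matrix_vector_mult_def sum_2 mat_def
        map_matrix_def field_simps)
  also have "\<dots> = of_real (((norm (plus_coord (Y s)))\<^sup>2 + (norm (minus_coord (Y s)))\<^sup>2) / 4)"
    unfolding of_real_divide of_real_add complex_norm_square
    by (simp add: plus_coord_def minus_coord_def field_simps)
  finally show ?thesis .
qed

text \<open>\<open>Q\<close> is the potential continued by zero past \<Lambda>, so that one formula
  for \<open>H\<close> covers both the core and the free tail.\<close>

locale perturbed_free_system =
  fixes \<Lambda> :: real and Q :: "real \<Rightarrow> complex" and \<tau> :: real and z :: complex and H :: "real \<Rightarrow> real^2^2"
  assumes \<Lambda>: "0 \<le> \<Lambda>"
    and H: "\<And>s. 0 \<le> s \<Longrightarrow> H s = mat (1/2) + \<tau> *\<^sub>R X_mat (Q s)"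
    and Q: "Q absolutely_integrable_on {0..\<Lambda>}" and Q0: "\<And>s. \<Lambda> \<le> s \<Longrightarrow> Q s = 0"
    and z: "0 < Im z"
begin

text \<open>This and \<open>decaying\<close> are \<alpha> and \<beta> of the overview. The names
  describe the unscaled coordinates on the tail, which grow and decay exponentially because
  \<open>Im z\<close> is positive; the rescaled functions are constant there.\<close>

definition growing :: "(real \<Rightarrow> complex^2) \<Rightarrow> real \<Rightarrow> complex" where
  "growing Y t = exp (\<i> * z / 2 * of_real t) * plus_coord (Y t)"

definition decaying :: "(real \<Rightarrow> complex^2) \<Rightarrow> real \<Rightarrow> complex" where
  "decaying Y t = exp (- (\<i> * z / 2) * of_real t) * minus_coord (Y t)"

text \<open>The sign is opposite to that in the equation for \<alpha>', because \<alpha> is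
  recovered by integrating backwards from \<Lambda>.\<close>

definition P :: "real \<Rightarrow> complex" where
  "P s = \<i> * z * \<tau> * Q s * exp (\<i> * z * of_real s)"

definition R :: "real \<Rightarrow> complex" where
  "R s = \<i> * z * \<tau> * cnj (Q s) * exp (- (\<i> * z) * of_real s)"

section \<open>Passage between canonical solutions and the two-point problem\<close>

lemma canonical_solution_growing_decaying:
  "canonical_solution H z Y \<longleftrightarrow>
    antiderivative (growing Y) (\<lambda>s. - P s * decaying Y s) \<and>
    antiderivative (decaying Y) (\<lambda>s. R s * growing Y s)"
  using canonical_solution_iff[of H \<tau> Q z Y] H
  by (simp add: growing_def[abs_def] decaying_def[abs_def] P_def R_def)

lemma P_R_absolutely_integrable:
  "P absolutely_integrable_on {0..\<Lambda>}" "R absolutely_integrable_on {0..\<Lambda>}"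
proof -
  have "(\<lambda>s. (\<i> * z * \<tau> * exp (\<i> * z * of_real s)) * Q s) absolutely_integrable_on {0..\<Lambda>}"
    by (intro absolutely_integrable_continuous_mult continuous_intros Q)
  then show "P absolutely_integrable_on {0..\<Lambda>}" by (simp add: P_def[abs_def] mult_ac)
  have "(\<lambda>s. (\<i> * z * \<tau> * exp (- (\<i> * z) * of_real s)) * (cnj \<circ> Q) s) absolutely_integrable_on {0..\<Lambda>}"
    by (intro absolutely_integrable_continuous_mult continuous_intros absolutely_integrable_linear
        bounded_linear_cnj Q)
  then show "R absolutely_integrable_on {0..\<Lambda>}" by (simp add: R_def[abs_def] mult_ac)
qed

lemma canonical_solution_tail:
  assumes "canonical_solution H z Y" "\<Lambda> \<le> t"
  shows "growing Y t = growing Y \<Lambda>" "decaying Y t = decaying Y \<Lambda>"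
proof -
  have "antiderivative (growing Y) (\<lambda>s. - P s * decaying Y s)"
    "antiderivative (decaying Y) (\<lambda>s. R s * growing Y s)"
    using assms(1) canonical_solution_growing_decaying by auto
  from this[THEN antiderivative_constant_tail, OF _ \<Lambda> assms(2)]
  show "growing Y t = growing Y \<Lambda>" "decaying Y t = decaying Y \<Lambda>"
    by (simp_all add: P_def R_def Q0)
qed

text \<open>The vanishing of \<alpha> at \<Lambda> determines \<alpha>(0), which turns the integral
  of -P \<beta> from 0 to t into the integral of P \<beta> from t to \<Lambda>.\<close>

lemma two_point_of_canonical:
  assumes Y: "canonical_solution H z Y" and "growing Y \<Lambda> = 0"
  shows "two_point_solution \<Lambda> P R (decaying Y 0) (growing Y) (decaying Y)"
proof -
  have g: "antiderivative (growing Y) (\<lambda>s. - P s * decaying Y s)"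
    and d: "antiderivative (decaying Y) (\<lambda>s. R s * growing Y s)"
    using Y canonical_solution_growing_decaying by auto
  show ?thesis
    unfolding two_point_solution_def
  proof (intro conjI ballI antiderivative_continuous_on[OF g] antiderivative_continuous_on[OF d])
    fix t assume t: "t \<in> {0..\<Lambda>}"
    show "decaying Y t = decaying Y 0 + integral {0..t} (\<lambda>s. R s * growing Y s)"
      using t by (intro antiderivativeD(3)[OF d]) auto
    let ?f = "\<lambda>s. - P s * decaying Y s"
    have "integral {0..t} ?f + integral {t..\<Lambda>} ?f = integral {0..\<Lambda>} ?f"
      using t \<Lambda> by (intro Henstock_Kurzweil_Integration.integral_combine antiderivativeD[OF g]) auto
    moreover have "growing Y t = growing Y 0 + integral {0..t} ?f"
      using t by (intro antiderivativeD(3)[OF g]) auto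
    moreover have "0 = growing Y 0 + integral {0..\<Lambda>} ?f"
      using antiderivativeD(3)[OF g \<Lambda>] assms(2) by simp
    moreover have "x = - b" if "a + b = c" "x = g + a" "0 = g + c" for a b c g x :: complex
      using that by (metis add.inverse_unique add.assoc add.commute add.left_neutral)
    ultimately have "growing Y t = - integral {t..\<Lambda>} ?f" by blast
    then show "growing Y t = integral {t..\<Lambda>} (\<lambda>s. P s * decaying Y s)" by simp
  qed
qed

text \<open>Past \<Lambda> the coupling is zero, so \<alpha> continues as 0 and \<beta> as
  \<beta>(\<Lambda>); then the rescaling is undone. The factor \<open>k\<close> leaves room to
  normalise the first component of \<open>Y 0\<close>.\<close>

lemma canonical_of_two_point:
  assumes "two_point_solution \<Lambda> P R 1 \<alpha> \<beta>"
  shows "\<exists>Y. canonical_solution H z Y \<and> growing Y \<Lambda> = 0 \<and> Y 0 = from_coords (k * \<alpha> 0) k"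
proof -
  note D = assms[unfolded two_point_solution_def]
  define a where "a t = (if t \<le> \<Lambda> then \<alpha> t else 0)" for t
  define b where "b t = (if t \<le> \<Lambda> then \<beta> t else \<beta> \<Lambda>)" for t
  have \<alpha>\<Lambda>: "\<alpha> \<Lambda> = 0"
    using D \<Lambda> by (metis atLeastAtMost_iff integral_singleton order_refl atLeastAtMost_singleton)
  have ca: "continuous_on {0..\<Lambda>} a" and cb: "continuous_on {0..\<Lambda>} b"
    using D continuous_on_cong[of "{0..\<Lambda>}" "{0..\<Lambda>}" a \<alpha>]
      continuous_on_cong[of "{0..\<Lambda>}" "{0..\<Lambda>}" b \<beta>]
    by (auto simp: a_def b_def)
  have aiP: "(\<lambda>s. - P s * b s) absolutely_integrable_on {0..\<Lambda>}"
    using absolutely_integrable_continuous_mult[OF _ P_R_absolutely_integrable(1), of "\<lambda>s. - b s"] cb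
    by (simp add: continuous_on_minus mult.commute)
  have aiR: "(\<lambda>s. R s * a s) absolutely_integrable_on {0..\<Lambda>}"
    using absolutely_integrable_continuous_mult[OF ca P_R_absolutely_integrable(2)]
    by (simp add: mult.commute)
  have a: "antiderivative a (\<lambda>s. - P s * b s)"
  proof (rule antiderivative_extend_constant[OF \<Lambda> aiP])
    fix t assume t: "t \<in> {0..\<Lambda>}"
    let ?f = "\<lambda>s. - P s * b s"
    have E: "a t = - integral {t..\<Lambda>} ?f" if "t \<in> {0..\<Lambda>}" for t
    proof -
      have "integral {t..\<Lambda>} (\<lambda>s. P s * \<beta> s) = integral {t..\<Lambda>} (\<lambda>s. P s * b s)"
        by (intro integral_cong) (simp add: b_def)
      then show ?thesis using D that by (simp add: a_def)
    qed
    have "integral {0..t} ?f + integral {t..\<Lambda>} ?f = integral {0..\<Lambda>} ?f"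
      using t aiP
      by (intro Henstock_Kurzweil_Integration.integral_combine) (auto simp: absolutely_integrable_on_def)
    moreover have "x = g + a" if "a + b = c" "x = - b" "g = - c" for a b c g x :: complex
      unfolding that(2,3) that(1)[symmetric] by simp
    moreover have "a 0 = - integral {0..\<Lambda>} ?f" using \<Lambda> by (intro E) auto
    ultimately show "a t = a 0 + integral {0..t} ?f"
      using E[OF t] by blast
  qed (auto simp: a_def P_def Q0 \<alpha>\<Lambda>)
  have b: "antiderivative b (\<lambda>s. R s * a s)"
  proof (rule antiderivative_extend_constant[OF \<Lambda> aiR])
    fix t assume t: "t \<in> {0..\<Lambda>}"
    have "integral {0..t} (\<lambda>s. R s * \<alpha> s) = integral {0..t} (\<lambda>s. R s * a s)"
      using t by (intro integral_cong) (simp add: a_def)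
    moreover have "\<beta> t = 1 + integral {0..t} (\<lambda>s. R s * \<alpha> s)" using D t by blast
    moreover have "\<beta> 0 = 1 + integral {0..0} (\<lambda>s. R s * \<alpha> s)" using D \<Lambda> atLeastAtMost_iff by blast
    ultimately show "b t = b 0 + integral {0..t} (\<lambda>s. R s * a s)"
      using t \<Lambda> by (simp add: b_def)
  qed (auto simp: b_def R_def Q0)
  define Y where "Y t = from_coords (exp (- (\<i> * z / 2) * of_real t) * (k * a t))
    (exp (\<i> * z / 2 * of_real t) * (k * b t))" for t
  have g: "growing Y = (\<lambda>t. k * a t)" and d: "decaying Y = (\<lambda>t. k * b t)"
    by (auto simp: growing_def decaying_def Y_def mult.assoc[symmetric] simp flip: exp_add)
  have "canonical_solution H z Y"
    unfolding canonical_solution_growing_decaying g d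
    using antiderivative_linear[OF a bounded_linear_mult_right[of k]]
      antiderivative_linear[OF b bounded_linear_mult_right[of k]]
    by (simp add: mult_ac)
  moreover have "growing Y \<Lambda> = 0" by (simp add: g a_def \<alpha>\<Lambda>)
  moreover have "\<beta> 0 = 1" using D \<Lambda> by auto
  then have "Y 0 = from_coords (k * \<alpha> 0) k" using \<Lambda> by (simp add: Y_def a_def b_def)
  ultimately show ?thesis by blast
qed

section \<open>Energy of a canonical solution on the core and on the tail\<close>

lemma energy_density_tail:
  assumes "canonical_solution H z Y" "\<Lambda> \<le> s"
  shows "energy_density H Y s = of_real ((exp (Im z * s) * (norm (growing Y \<Lambda>))\<^sup>2 +
      exp (- Im z * s) * (norm (decaying Y \<Lambda>))\<^sup>2) / 4)"
proof -
  have p: "plus_coord (Y s) = exp (- (\<i> * z / 2) * of_real s) * growing Y \<Lambda>"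
    unfolding canonical_solution_tail(1)[OF assms, symmetric]
    by (simp add: growing_def mult.assoc[symmetric] flip: exp_add)
  have n: "minus_coord (Y s) = exp (\<i> * z / 2 * of_real s) * decaying Y \<Lambda>"
    unfolding canonical_solution_tail(2)[OF assms, symmetric]
    by (simp add: decaying_def mult.assoc[symmetric] flip: exp_add)
  have e: "(exp (c / 2))\<^sup>2 = exp c" for c :: real
    by (simp add: power2_eq_square flip: exp_add)
  have Hs: "H s = mat (1/2)"
    using H[of s] Q0[OF assms(2)] \<Lambda> assms(2) by (simp add: X_mat_def vec_eq_iff forall_2)
  then show ?thesis
    unfolding energy_density_free[of H s Y, OF Hs] p n norm_mult norm_exp_eq_Re power_mult_distrib
    using e[of "Im z * s"] e[of "- (Im z * s)"] by simp
qed

lemma energy_absolutely_integrable_core: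
  assumes "canonical_solution H z Y"
  shows "energy_density H Y absolutely_integrable_on {0..\<Lambda>}"
proof -
  obtain Y' where "antiderivative Y Y'"
    using assms unfolding canonical_solution_def antiderivative_def by blast
  then have "continuous_on {0..\<Lambda>} Y" by (rule antiderivative_continuous_on)
  then have c: "continuous_on {0..\<Lambda>} (\<lambda>s. Y s $ i)" for i
    by (rule continuous_on_component)
  have q: "(\<lambda>s. complex_of_real (Re (Q s))) absolutely_integrable_on {0..\<Lambda>}"
    "(\<lambda>s. complex_of_real (Im (Q s))) absolutely_integrable_on {0..\<Lambda>}"
    using absolutely_integrable_linear[OF Q bounded_linear_compose[OF bounded_linear_of_real bounded_linear_Re]]
      absolutely_integrable_linear[OF Q bounded_linear_compose[OF bounded_linear_of_real bounded_linear_Im]]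
    by (simp_all add: o_def)
  define e0 e1 e2 where "e0 s = (cnj (Y s $ 1) * Y s $ 1 + cnj (Y s $ 2) * Y s $ 2) / 2"
    and "e1 s = of_real \<tau> * (cnj (Y s $ 1) * Y s $ 1 - cnj (Y s $ 2) * Y s $ 2)"
    and "e2 s = of_real \<tau> * (cnj (Y s $ 1) * Y s $ 2 + cnj (Y s $ 2) * Y s $ 1)" for s
  have ce: "continuous_on {0..\<Lambda>} e0" "continuous_on {0..\<Lambda>} e1" "continuous_on {0..\<Lambda>} e2"
    unfolding e0_def e1_def e2_def by (intro continuous_intros c; simp)+
  have "(\<lambda>s. e0 s + e1 s * of_real (Re (Q s)) + e2 s * of_real (Im (Q s))) absolutely_integrable_on {0..\<Lambda>}"
    using ce
    by (intro set_integral_add(1) absolutely_integrable_continuous_mult q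
        absolutely_integrable_continuous_real)
  then show ?thesis
  proof (rule absolutely_integrable_spike[where S="{}"])
    fix s assume "s \<in> {0..\<Lambda>} - {}"
    then have "0 \<le> s" by simp
    then show "energy_density H Y s = e0 s + e1 s * of_real (Re (Q s)) + e2 s * of_real (Im (Q s))"
      unfolding e0_def e1_def e2_def by (intro energy_density_perturbed H)
  qed simp
qed

text \<open>The core always has finite energy. On the tail the energy is a decaying exponential
  weighted by |\<beta>(\<Lambda>)|^2 plus a growing one weighted by |\<alpha>(\<Lambda>)|^2, and the
  latter is integrable only if its weight is zero.\<close>

lemma energy_absolutely_integrable_iff:
  assumes Y: "canonical_solution H z Y"
  shows "energy_density H Y absolutely_integrable_on {0..} \<longleftrightarrow> growing Y \<Lambda> = 0"
proof
  assume g: "growing Y \<Lambda> = 0"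
  define K where "K = (norm (decaying Y \<Lambda>))\<^sup>2 / 4"
  have "(\<lambda>s. exp (- Im z * s)) absolutely_integrable_on {\<Lambda>..}"
    by (intro nonnegative_absolutely_integrable_1 integrable_on_exp_minus_to_infinity z) auto
  from absolutely_integrable_linear[OF this
      bounded_linear_compose[OF bounded_linear_of_real bounded_linear_mult_left[of K]], unfolded o_def]
  have "(\<lambda>s. complex_of_real (exp (- Im z * s) * K)) absolutely_integrable_on {\<Lambda>..}" .
  then have "energy_density H Y absolutely_integrable_on {\<Lambda>..}"
    by (rule absolutely_integrable_spike[where S="{}"]) (auto simp: energy_density_tail[OF Y] g K_def)
  then have "energy_density H Y absolutely_integrable_on {0..\<Lambda>} \<union> {\<Lambda>..}"
    by (intro set_integrable_Un energy_absolutely_integrable_core Y) auto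
  also have "{0..\<Lambda>} \<union> {\<Lambda>..} = {0..}" using \<Lambda> by auto
  finally show "energy_density H Y absolutely_integrable_on {0..}" .
next
  assume "energy_density H Y absolutely_integrable_on {0..}"
  then have "energy_density H Y absolutely_integrable_on {\<Lambda>..}"
    by (rule set_integrable_subset) (use \<Lambda> in auto)
  then have I: "(\<lambda>s. norm (energy_density H Y s)) integrable_on {\<Lambda>..}"
    by (simp add: absolutely_integrable_on_def)
  \<comment> \<open>Since \<open>0 \<le> \<Lambda>\<close>, the growing exponential is at least 1 on
    the tail, so \<open>k\<close> bounds the energy from below there. A positive \<open>k\<close>
    would make the integrals over intervals of length \<open>n\<close> unbounded.\<close>
  define k where "k = (norm (growing Y \<Lambda>))\<^sup>2 / 4"
  have le: "k \<le> norm (energy_density H Y s)" if "\<Lambda> \<le> s" for s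
  proof -
    have "1 \<le> exp (Im z * s)" using z \<Lambda> that by simp
    then have "(norm (growing Y \<Lambda>))\<^sup>2 \<le> exp (Im z * s) * (norm (growing Y \<Lambda>))\<^sup>2"
      by (simp add: mult_le_cancel_right1)
    then show ?thesis
      unfolding energy_density_tail[OF Y that] norm_of_real k_def by (simp add: add_increasing2)
  qed
  have bound: "k * real n \<le> integral {\<Lambda>..} (\<lambda>s. norm (energy_density H Y s))" for n
  proof -
    have "k * real n = integral {\<Lambda>..\<Lambda> + real n} (\<lambda>_. k)" by simp
    also have "\<dots> \<le> integral {\<Lambda>..\<Lambda> + real n} (\<lambda>s. norm (energy_density H Y s))"
      using le by (intro integral_le integrable_on_subinterval[OF I]) auto
    also have "\<dots> \<le> integral {\<Lambda>..} (\<lambda>s. norm (energy_density H Y s))"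
      by (intro integral_subset_le integrable_on_subinterval[OF I] I) auto
    finally show ?thesis .
  qed
  show "growing Y \<Lambda> = 0"
  proof (rule ccontr)
    assume "growing Y \<Lambda> \<noteq> 0"
    then have "0 < k" by (simp add: k_def)
    then show False
      using reals_Archimedean3[of k] bound by (metis mult.commute not_le)
  qed
qed

end

section \<open>First-order expansion of the Schur transform\<close>

context perturbed_free_system
begin

text \<open>\<open>A\<close> is \<alpha>(0) for the solution with \<beta>(0) = 1. By uniqueness
  every square-integrable solution has \<alpha>(0) = A \<beta>(0), and Y(0) = (1, m) turns this into
  1 + im = A (1 - im), which determines m. The condition \<open>2 * p < 1\<close> forces |A| < 1 and
  so excludes A = -1. The equivalence is the form in which the definite description in
  \<open>weyl_coefficient\<close> can be evaluated.\<close>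

lemma weyl_solution_iff:
  defines "p \<equiv> integral {0..\<Lambda>} (\<lambda>s. norm (P s))" and "r \<equiv> integral {0..\<Lambda>} (\<lambda>s. norm (R s))"
  assumes small: "p * r \<le> 1/2" "2 * p < 1"
  shows "\<exists>A. norm (A - integral {0..\<Lambda>} P) \<le> 2 * p * r * p \<and> A \<noteq> -1 \<and>
    (\<forall>m. (\<exists>Y. canonical_solution H z Y \<and> Y 0 = vector [1, m] \<and>
               energy_density H Y absolutely_integrable_on {0..}) \<longleftrightarrow>
         m = (A - 1) / (\<i> * (1 + A)))"
proof -
  note two_point = \<Lambda> P_R_absolutely_integrable small(1)[unfolded p_def r_def]
  obtain \<alpha> \<beta> where ab: "two_point_solution \<Lambda> P R 1 \<alpha> \<beta>"
    using two_point_solution_exists[OF two_point] by blast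
  have 0: "0 \<in> {0..\<Lambda>}" using \<Lambda> by simp
  have approx: "norm (\<alpha> 0 - integral {0..\<Lambda>} P) \<le> 2 * p * r * p"
    using two_point_solution_approx[OF two_point ab] by (simp add: p_def r_def mult_ac)
  have "norm (\<alpha> 0) < 1"
    using two_point_solution_bound(2)[OF two_point ab 0] small(2) by (simp add: p_def)
  then have A: "\<alpha> 0 \<noteq> -1" by auto
  then have A': "1 + \<alpha> 0 \<noteq> 0" by (simp add: add_eq_0_iff)
  show ?thesis
  proof (intro exI[of _ "\<alpha> 0"] conjI allI iffI approx A)
    fix m
    assume "\<exists>Y. canonical_solution H z Y \<and> Y 0 = vector [1, m] \<and>
               energy_density H Y absolutely_integrable_on {0..}"
    then obtain Y where Y: "canonical_solution H z Y" "Y 0 = vector [1, m]" "growing Y \<Lambda> = 0"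
      using energy_absolutely_integrable_iff by blast
    have "growing Y 0 = decaying Y 0 * \<alpha> 0"
      by (rule two_point_solution_unique[OF two_point two_point_of_canonical[OF Y(1,3)] ab 0])
    then have "1 + \<i> * m = (1 - \<i> * m) * \<alpha> 0"
      by (simp add: growing_def decaying_def Y(2) plus_coord_def minus_coord_def)
    then have "m * (\<i> * (1 + \<alpha> 0)) = \<alpha> 0 - 1"
      by algebra
    then show "m = (\<alpha> 0 - 1) / (\<i> * (1 + \<alpha> 0))"
      using A' by (simp add: nonzero_eq_divide_eq)
  next
    fix m assume m: "m = (\<alpha> 0 - 1) / (\<i> * (1 + \<alpha> 0))"
    \<comment> \<open>Chosen so that the first component \<open>(k * \<alpha> 0 + k) / 2\<close> of
      the initial vector is 1.\<close>
    define k where "k = 2 / (1 + \<alpha> 0)"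
    obtain Y where Y: "canonical_solution H z Y" "growing Y \<Lambda> = 0" "Y 0 = from_coords (k * \<alpha> 0) k"
      using canonical_of_two_point[OF ab, of k] by blast
    have k: "k * (1 + \<alpha> 0) = 2"
      using nonzero_eq_divide_eq[OF A'] k_def by blast
    have "m * (\<i> * (1 + \<alpha> 0)) = \<alpha> 0 - 1"
      using nonzero_eq_divide_eq[of "\<i> * (1 + \<alpha> 0)"] A' m by simp
    then have "k * \<alpha> 0 - k = m * (2 * \<i>)"
      using k by algebra
    then have "(k * \<alpha> 0 - k) / (2 * \<i>) = m"
      by (simp only:) (rule nonzero_mult_div_cancel_right, simp)
    moreover have "k * \<alpha> 0 + k = 2" using k by (simp add: distrib_left add.commute)
    ultimately have "from_coords (k * \<alpha> 0) k = vector [1, m]"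
      unfolding from_coords_def by simp
    then show "\<exists>Y. canonical_solution H z Y \<and> Y 0 = vector [1, m] \<and>
               energy_density H Y absolutely_integrable_on {0..}"
      using Y energy_absolutely_integrable_iff by auto
  qed
qed

end

text \<open>The Schur transform equals -A with \<open>A\<close> from
  \<open>weyl_solution_iff\<close>, and A differs from the integral of P, which is -\<tau> D, by a
  term of order |\<tau>|^3.\<close>

lemma schur_transform_first_order:
  fixes H0 :: "real \<Rightarrow> real^2^2" and q :: "real \<Rightarrow> complex"
  assumes \<Lambda>: "0 \<le> \<Lambda>" and H0: "\<And>s. s \<in> {0..\<Lambda>} \<Longrightarrow> H0 s = mat (1/2)"
    and q: "q \<in> L1 \<Lambda>" and z: "0 < Im z"
  defines "D \<equiv> - \<i> * z * integral {0..\<Lambda>} (\<lambda>s. q s * exp (\<i> * z * of_real s))"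
  shows "((\<lambda>\<tau>. schur_transform (perturbed H0 q \<tau>) \<Lambda> z) has_vector_derivative D) (at 0)"
proof -
  \<comment> \<open>\<open>free_tail\<close> switches at the strict inequality
    \<open>s < \<Lambda>\<close> and thus has the free value at \<Lambda> itself, so
    \<open>Q\<close> must vanish there too. The single point does not affect integrals.\<close>
  define Q where "Q s = (if s < \<Lambda> then q s else 0)" for s
  have "q absolutely_integrable_on {0..\<Lambda>}"
    using q by (simp add: L1_def)
  then have Qai: "Q absolutely_integrable_on {0..\<Lambda>}"
    by (rule absolutely_integrable_spike[where S="{\<Lambda>}"]) (auto simp: Q_def)
  have sys: "perturbed_free_system \<Lambda> Q \<tau> z (free_tail \<Lambda> (perturbed H0 q \<tau>))" for \<tau>
  proof
    show "free_tail \<Lambda> (perturbed H0 q \<tau>) s = mat (1/2) + \<tau> *\<^sub>R X_mat (Q s)" if "0 \<le> s" for s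
      using H0[of s] that
      by (auto simp: free_tail_def perturbed_def Q_def X_mat_def vec_eq_iff forall_2)
  qed (use \<Lambda> z Qai in \<open>auto simp: Q_def\<close>)
  \<comment> \<open>Both coefficients are linear in \<tau>; taking them at \<tau> = 1 makes
    \<open>p\<close> and \<open>r\<close> independent of \<tau>, so the smallness conditions hold
    for all \<tau> near 0.\<close>
  define P1 R1 where "P1 = perturbed_free_system.P Q 1 z" and "R1 = perturbed_free_system.R Q 1 z"
  define p r where "p = integral {0..\<Lambda>} (\<lambda>s. norm (P1 s))" and "r = integral {0..\<Lambda>} (\<lambda>s. norm (R1 s))"
  let ?v = "\<lambda>\<tau>. schur_transform (perturbed H0 q \<tau>) \<Lambda> z"
  have P1: "perturbed_free_system.P Q \<tau> z s = of_real \<tau> * P1 s"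
    and R1: "perturbed_free_system.R Q \<tau> z s = of_real \<tau> * R1 s" for \<tau> s
    unfolding P1_def R1_def perturbed_free_system.P_def[OF sys] perturbed_free_system.R_def[OF sys]
    by simp_all
  have D: "integral {0..\<Lambda>} P1 = - D"
  proof -
    have "integral {0..\<Lambda>} P1 = integral {0..\<Lambda>} (\<lambda>s. \<i> * z * (q s * exp (\<i> * z * of_real s)))"
      by (rule integral_spike[where S="{\<Lambda>}"])
         (auto simp: P1_def perturbed_free_system.P_def[OF sys] Q_def)
    then show ?thesis by (simp add: D_def)
  qed
  have v: "norm (?v \<tau> - of_real \<tau> * D) \<le> 2 * p * r * p * \<bar>\<tau>\<bar> ^ 3"
    if small: "\<bar>\<tau>\<bar> * p * (\<bar>\<tau>\<bar> * r) \<le> 1/2" "2 * (\<bar>\<tau>\<bar> * p) < 1" for \<tau>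
  proof -
    interpret perturbed_free_system \<Lambda> Q \<tau> z "free_tail \<Lambda> (perturbed H0 q \<tau>)" by (rule sys)
    have pr: "integral {0..\<Lambda>} (\<lambda>s. norm (P s)) = \<bar>\<tau>\<bar> * p" "integral {0..\<Lambda>} (\<lambda>s. norm (R s)) = \<bar>\<tau>\<bar> * r"
      by (simp_all add: P1 R1 p_def r_def norm_mult)
    have PD: "integral {0..\<Lambda>} P = - (of_real \<tau> * D)"
      using D by (simp add: P1[abs_def])
    obtain A where A: "norm (A - integral {0..\<Lambda>} P) \<le> 2 * (\<bar>\<tau>\<bar> * p) * (\<bar>\<tau>\<bar> * r) * (\<bar>\<tau>\<bar> * p)" "A \<noteq> -1"
      and m: "\<And>m. (\<exists>Y. canonical_solution (free_tail \<Lambda> (perturbed H0 q \<tau>)) z Y \<and> Y 0 = vector [1, m] \<and>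
               energy_density (free_tail \<Lambda> (perturbed H0 q \<tau>)) Y absolutely_integrable_on {0..}) \<longleftrightarrow>
         m = (A - 1) / (\<i> * (1 + A))"
      using weyl_solution_iff[unfolded pr, OF small] by blast
    have A': "1 + A \<noteq> 0" using A(2) by (simp add: add_eq_0_iff)
    have w: "weyl_coefficient (perturbed H0 q \<tau>) \<Lambda> z = (A - 1) / (\<i> * (1 + A))"
      unfolding weyl_coefficient_def m by simp
    define m where "m = (A - 1) / (\<i> * (1 + A))"
    have mA: "m * (\<i> * (1 + A)) = A - 1"
      using nonzero_eq_divide_eq[of "\<i> * (1 + A)"] A' m_def by simp
    \<comment> \<open>The value -i for m would turn \<open>mA\<close> into 1 + A = A - 1. So the
      denominator of the Schur transform is nonzero, and the transform inverts the Moebius map from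
      A to m up to sign.\<close>
    then have "m \<noteq> - \<i>" by auto
    then have "m + \<i> \<noteq> 0" by (simp add: eq_neg_iff_add_eq_0)
    moreover have "m - \<i> = - A * (m + \<i>)" using mA i_squared by algebra
    ultimately have "?v \<tau> = - A"
      unfolding schur_transform_def w m_def[symmetric] by simp
    then have "norm (?v \<tau> - of_real \<tau> * D) = norm (A - integral {0..\<Lambda>} P)"
      unfolding PD by (simp add: norm_minus_commute[of "- A"] add.commute)
    also note A(1)
    also have "2 * (\<bar>\<tau>\<bar> * p) * (\<bar>\<tau>\<bar> * r) * (\<bar>\<tau>\<bar> * p) = 2 * p * r * p * \<bar>\<tau>\<bar> ^ 3"
      by (simp add: power3_eq_cube)
    finally show ?thesis .
  qed
  \<comment> \<open>At \<tau> = 0 the cubic error bound itself is zero.\<close>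
  have v0: "?v 0 = 0" using v[of 0] by simp
  have ev: "\<forall>\<^sub>F \<tau> in at 0. \<bar>\<tau>\<bar> * p * (\<bar>\<tau>\<bar> * r) < 1/2 \<and> 2 * (\<bar>\<tau>\<bar> * p) < 1"
  proof (intro eventually_conj order_tendstoD(2))
    show "((\<lambda>\<tau>. \<bar>\<tau>\<bar> * p * (\<bar>\<tau>\<bar> * r)) \<longlongrightarrow> 0) (at 0)" "((\<lambda>\<tau>. 2 * (\<bar>\<tau>\<bar> * p)) \<longlongrightarrow> 0) (at 0)"
      by (auto intro!: tendsto_eq_intros)
  qed auto
  show ?thesis
    unfolding has_vector_derivative_def has_derivative_within v0
  proof (intro conjI bounded_linear_scaleR_left)
    have lim: "((\<lambda>\<tau>. 2 * p * r * p * \<bar>\<tau>\<bar>\<^sup>2) \<longlongrightarrow> 0) (at 0)"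
      by (auto intro!: tendsto_eq_intros)
    show "((\<lambda>\<tau>. (1 / norm (\<tau> - 0)) *\<^sub>R (?v \<tau> - (0 + (\<tau> - 0) *\<^sub>R D))) \<longlongrightarrow> 0) (at 0)"
    proof (rule Lim_null_comparison[OF _ lim])
      have "\<forall>\<^sub>F \<tau> in at (0::real). \<tau> \<noteq> 0" by (simp add: eventually_at_filter)
      with ev show "\<forall>\<^sub>F \<tau> in at 0. norm ((1 / norm (\<tau> - 0)) *\<^sub>R (?v \<tau> - (0 + (\<tau> - 0) *\<^sub>R D))) \<le> 2 * p * r * p * \<bar>\<tau>\<bar>\<^sup>2"
      proof eventually_elim
        case (elim \<tau>)
        then have "norm (?v \<tau> - of_real \<tau> * D) \<le> 2 * p * r * p * \<bar>\<tau>\<bar> ^ 3"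
          by (intro v) auto
        then show ?case
          using elim by (simp add: scaleR_conv_of_real[of \<tau> D] pos_divide_le_eq power2_eq_square power3_eq_cube mult.assoc)
      qed
    qed
  qed
qed

section \<open>Functionals on the space of integrable functions\<close>

lemma absolutely_integrable_mult_exp:
  assumes "q \<in> L1 \<Lambda>"
  shows "(\<lambda>s. q s * exp (\<i> * z * of_real s)) absolutely_integrable_on {0..\<Lambda>}"
proof -
  have "(\<lambda>s. exp (\<i> * z * of_real s) * q s) absolutely_integrable_on {0..\<Lambda>}"
    using assms unfolding L1_def
    by (intro absolutely_integrable_continuous_mult continuous_intros) auto
  then show ?thesis by (simp add: mult.commute)
qed

text \<open>On the interval \<open>exp (\<i> * z * of_real s)\<close> has modulus at most 1, as both
  \<open>s\<close> and \<open>Im z\<close> are nonnegative; |z| therefore serves as the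
  bound.\<close>

lemma L1_bounded_linear_fourier_laplace:
  assumes "0 \<le> Im z"
  shows "L1_bounded_linear \<Lambda>
    (\<lambda>q. - \<i> * z * integral {0..\<Lambda>} (\<lambda>s. q s * exp (\<i> * z * of_real s)))"
  unfolding L1_bounded_linear_def
proof (intro conjI ballI allI exI)
  fix q r :: "real \<Rightarrow> complex" and c
  assume q: "q \<in> L1 \<Lambda>"
  have I: "(\<lambda>s. q s * exp (\<i> * z * of_real s)) integrable_on {0..\<Lambda>}" if "q \<in> L1 \<Lambda>" for q
    using absolutely_integrable_mult_exp[OF that] set_lebesgue_integral_eq_integral(1) by blast
  show "- \<i> * z * integral {0..\<Lambda>} (\<lambda>s. (q s + r s) * exp (\<i> * z * of_real s)) =
      - \<i> * z * integral {0..\<Lambda>} (\<lambda>s. q s * exp (\<i> * z * of_real s)) +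
      - \<i> * z * integral {0..\<Lambda>} (\<lambda>s. r s * exp (\<i> * z * of_real s))" if "r \<in> L1 \<Lambda>"
    unfolding distrib_right integral_add[OF I[OF q] I[OF that]] by (simp add: distrib_left)
  show "- \<i> * z * integral {0..\<Lambda>} (\<lambda>s. c * q s * exp (\<i> * z * of_real s)) =
      c * (- \<i> * z * integral {0..\<Lambda>} (\<lambda>s. q s * exp (\<i> * z * of_real s)))"
    by (simp add: mult.assoc)
  have "norm (integral {0..\<Lambda>} (\<lambda>s. q s * exp (\<i> * z * of_real s))) \<le> L1_norm \<Lambda> q"
    unfolding L1_norm_def
  proof (intro integral_norm_bound_integral I q)
    show "(\<lambda>s. norm (q s)) integrable_on {0..\<Lambda>}"
      using q by (simp add: L1_def absolutely_integrable_on_def)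
    fix s assume "s \<in> {0..\<Lambda>}"
    then have "norm (exp (\<i> * z * of_real s)) \<le> 1"
      using assms by (simp add: norm_exp_eq_Re)
    then show "norm (q s * exp (\<i> * z * of_real s)) \<le> norm (q s)"
      by (simp add: norm_mult mult_left_le)
  qed
  then show "norm (- \<i> * z * integral {0..\<Lambda>} (\<lambda>s. q s * exp (\<i> * z * of_real s))) \<le> norm z * L1_norm \<Lambda> q"
    by (simp add: norm_mult mult_left_mono)
qed

lemma L1_norm_nonneg: "0 \<le> L1_norm \<Lambda> q"
proof (cases "(\<lambda>s. norm (q s)) integrable_on {0..\<Lambda>}")
  case True
  then show ?thesis by (simp add: L1_norm_def integral_nonneg)
\<comment> \<open>By convention the integral of a non-integrable function is 0.\<close>
qed (simp add: L1_norm_def not_integrable_integral)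

lemma L1_bounded_linear_imp_continuous:
  assumes "L1_bounded_linear \<Lambda> F"
  shows "L1_continuous \<Lambda> F"
  unfolding L1_continuous_def
proof (intro ballI allI impI)
  fix q \<epsilon> assume q: "q \<in> L1 \<Lambda>" and \<epsilon>: "0 < (\<epsilon> :: real)"
  obtain C where C: "\<And>q. q \<in> L1 \<Lambda> \<Longrightarrow> norm (F q) \<le> C * L1_norm \<Lambda> q"
    and add: "\<And>q r. q \<in> L1 \<Lambda> \<Longrightarrow> r \<in> L1 \<Lambda> \<Longrightarrow> F (\<lambda>s. q s + r s) = F q + F r"
    using assms unfolding L1_bounded_linear_def by blast
  \<comment> \<open>The denominator is |C| + 1 because the constant \<open>C\<close> may be zero or
    negative.\<close>
  have "norm (F r - F q) < \<epsilon>" if r: "r \<in> L1 \<Lambda>" "L1_norm \<Lambda> (\<lambda>s. r s - q s) < \<epsilon> / (\<bar>C\<bar> + 1)" for r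
  proof -
    let ?d = "\<lambda>s. r s - q s"
    have d: "?d \<in> L1 \<Lambda>" using q r by (simp add: L1_def set_integral_diff(1))
    have "F r = F ?d + F q" using add[OF d q] by simp
    then have "norm (F r - F q) \<le> C * L1_norm \<Lambda> ?d" using C[OF d] by simp
    also have "\<dots> \<le> (\<bar>C\<bar> + 1) * L1_norm \<Lambda> ?d"
      by (intro mult_right_mono L1_norm_nonneg) auto
    also have "\<dots> < \<epsilon>" using r(2) by (simp add: pos_less_divide_eq mult.commute)
    finally show ?thesis .
  qed
  then show "\<exists>\<delta>>0. \<forall>r\<in>L1 \<Lambda>. L1_norm \<Lambda> (\<lambda>s. r s - q s) < \<delta> \<longrightarrow> norm (F r - F q) < \<epsilon>"
    using \<epsilon> by (intro exI[of _ "\<epsilon> / (\<bar>C\<bar> + 1)"]) auto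
qed

section \<open>Density of the bounded functions and uniqueness of the extension\<close>

lemma L1_continuous_tendsto:
  assumes F: "L1_continuous \<Lambda> F" and q: "q \<in> L1 \<Lambda>" and f: "\<And>n. f n \<in> L1 \<Lambda>"
    and lim: "(\<lambda>n. L1_norm \<Lambda> (\<lambda>s. f n s - q s)) \<longlonglongrightarrow> 0"
  shows "(\<lambda>n. F (f n)) \<longlonglongrightarrow> F q"
proof (rule tendstoI)
  fix e :: real assume "0 < e"
  then obtain d where d: "d > 0" "\<And>r. r \<in> L1 \<Lambda> \<Longrightarrow> L1_norm \<Lambda> (\<lambda>s. r s - q s) < d \<Longrightarrow> norm (F r - F q) < e"
    using F q unfolding L1_continuous_def by metis
  from order_tendstoD(2)[OF lim d(1)] show "\<forall>\<^sub>F n in sequentially. dist (F (f n)) (F q) < e"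
    by eventually_elim (simp add: dist_norm d(2) f)
qed

text \<open>Set \<open>q\<close> to 0 where its modulus exceeds \<open>n\<close>. The errors are
  dominated by |q| and vanish at each point for large \<open>n\<close>, so dominated convergence
  applies.\<close>

lemma L1_truncation:
  assumes q: "q \<in> L1 \<Lambda>"
  obtains f where "\<And>n. f n \<in> L1 \<Lambda> \<inter> Linf \<Lambda>" "(\<lambda>n. L1_norm \<Lambda> (\<lambda>s. f n s - q s)) \<longlonglongrightarrow> 0"
proof
  define f where "f n s = (if norm (q s) \<le> real n then q s else 0)" for n s
  have qa: "q absolutely_integrable_on {0..\<Lambda>}" using q by (simp add: L1_def)
  then have nq: "(\<lambda>s. norm (q s)) integrable_on {0..\<Lambda>}"
    by (simp add: absolutely_integrable_on_def)
  have qm [measurable]: "q \<in> borel_measurable (lebesgue_on {0..\<Lambda>})"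
    using qa by (simp add: absolutely_integrable_measurable)
  have fm: "f n \<in> borel_measurable (lebesgue_on {0..\<Lambda>})" for n
    unfolding f_def[abs_def] by measurable
  have fa: "f n absolutely_integrable_on {0..\<Lambda>}" for n
    by (rule measurable_bounded_by_integrable_imp_absolutely_integrable[OF fm _ nq]) (auto simp: f_def)
  show "f n \<in> L1 \<Lambda> \<inter> Linf \<Lambda>" for n
    using fa fm by (auto simp: L1_def Linf_def f_def intro!: exI[of _ "real n"])
  have "(\<lambda>n. integral {0..\<Lambda>} (\<lambda>s. norm (f n s - q s))) \<longlonglongrightarrow> integral {0..\<Lambda>} (\<lambda>_. 0 :: real)"
  proof (rule dominated_convergence(2)[OF _ nq])
    show "(\<lambda>s. norm (f n s - q s)) integrable_on {0..\<Lambda>}" for n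
      using set_integral_diff(1)[OF fa qa] by (simp add: absolutely_integrable_on_def)
    show "norm (norm (f n s - q s)) \<le> norm (q s)" for n s by (simp add: f_def)
    show "(\<lambda>n. norm (f n s - q s)) \<longlonglongrightarrow> 0" for s
    proof (rule tendsto_eventually)
      obtain N where "norm (q s) \<le> real N" using real_arch_simple by blast
      then show "\<forall>\<^sub>F n in sequentially. norm (f n s - q s) = 0"
        by (intro eventually_sequentiallyI[of N]) (simp add: f_def)
    qed
  qed
  then show "(\<lambda>n. L1_norm \<Lambda> (\<lambda>s. f n s - q s)) \<longlonglongrightarrow> 0" by (simp add: L1_norm_def)
qed

text \<open>From right to left this is existence of the continuous extension, from left to right its
  uniqueness: continuous functionals that agree on bounded functions agree in the limit along
  truncations.\<close>

lemma L1_extension_unique: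
  assumes F: "L1_continuous \<Lambda> F"
  shows "L1_continuous \<Lambda> G \<and> (\<forall>q\<in>L1 \<Lambda> \<inter> Linf \<Lambda>. G q = F q) \<longleftrightarrow> (\<forall>q\<in>L1 \<Lambda>. G q = F q)"
proof safe
  fix q assume G: "L1_continuous \<Lambda> G" "\<forall>q\<in>L1 \<Lambda> \<inter> Linf \<Lambda>. G q = F q" and q: "q \<in> L1 \<Lambda>"
  obtain f where f: "\<And>n. f n \<in> L1 \<Lambda> \<inter> Linf \<Lambda>" "(\<lambda>n. L1_norm \<Lambda> (\<lambda>s. f n s - q s)) \<longlonglongrightarrow> 0"
    by (rule L1_truncation[OF q]) blast
  have "(\<lambda>n. G (f n)) \<longlonglongrightarrow> G q" "(\<lambda>n. F (f n)) \<longlonglongrightarrow> F q"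
    using f(1) by (auto intro: L1_continuous_tendsto[OF G(1) q _ f(2)] L1_continuous_tendsto[OF F q _ f(2)])
  moreover have "G (f n) = F (f n)" for n using f(1) G(2) by blast
  ultimately show "G q = F q" using LIMSEQ_unique by simp
next
  assume "\<forall>q\<in>L1 \<Lambda>. G q = F q"
  then show "L1_continuous \<Lambda> G" using F unfolding L1_continuous_def by simp
qed auto

text \<open>Differentiability is asserted next to the value of \<open>D_schur\<close> because
  \<open>vector_derivative\<close> is a choice operator, whose value alone does not show that a
  derivative exists. The equivalence over all \<open>G\<close> states existence and uniqueness of
  the continuous extension at once.\<close>

theorem theorem3p3:
  fixes \<Lambda> :: real and H0 :: "real \<Rightarrow> real^2^2"
  assumes "\<Lambda> > 0"
    and "\<And>s. s \<in> {0..\<Lambda>} \<Longrightarrow> H0 s = mat (1/2)"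
  shows "(\<forall>q \<in> L1 \<Lambda> \<inter> Linf \<Lambda>. \<forall>z. Im z > 0 \<longrightarrow>
            (\<lambda>\<tau>. schur_transform (perturbed H0 q \<tau>) \<Lambda> z) differentiable (at 0) \<and>
            D_schur H0 \<Lambda> z q = - \<i> * z * integral {0..\<Lambda>} (\<lambda>s. q s * exp (\<i> * z * of_real s)))
       \<and> (\<forall>z. Im z > 0 \<longrightarrow>
            (\<forall>q \<in> L1 \<Lambda>. (\<lambda>s. q s * exp (\<i> * z * of_real s)) absolutely_integrable_on {0..\<Lambda>}) \<and>
            L1_bounded_linear \<Lambda>
              (\<lambda>q. - \<i> * z * integral {0..\<Lambda>} (\<lambda>s. q s * exp (\<i> * z * of_real s))) \<and>
            (\<forall>G. L1_continuous \<Lambda> G \<and> (\<forall>q \<in> L1 \<Lambda> \<inter> Linf \<Lambda>. G q = D_schur H0 \<Lambda> z q) \<longleftrightarrow>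
                 (\<forall>q \<in> L1 \<Lambda>. G q =
                    - \<i> * z * integral {0..\<Lambda>} (\<lambda>s. q s * exp (\<i> * z * of_real s)))))"
proof -
  let ?F = "\<lambda>z q. - \<i> * z * integral {0..\<Lambda>} (\<lambda>s. q s * exp (\<i> * z * of_real s))"
  have der: "((\<lambda>\<tau>. schur_transform (perturbed H0 q \<tau>) \<Lambda> z) has_vector_derivative ?F z q) (at 0)"
    if "q \<in> L1 \<Lambda>" "0 < Im z" for q z
    using assms that by (intro schur_transform_first_order) auto
  then have D: "D_schur H0 \<Lambda> z q = ?F z q" if "q \<in> L1 \<Lambda>" "0 < Im z" for q z
    unfolding D_schur_def using that by (intro vector_derivative_at)
  have ext: "L1_continuous \<Lambda> G \<and> (\<forall>q\<in>L1 \<Lambda> \<inter> Linf \<Lambda>. G q = D_schur H0 \<Lambda> z q) \<longleftrightarrow>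
      (\<forall>q\<in>L1 \<Lambda>. G q = ?F z q)" if z: "0 < Im z" for G z
  proof -
    have "(\<forall>q\<in>L1 \<Lambda> \<inter> Linf \<Lambda>. G q = D_schur H0 \<Lambda> z q) \<longleftrightarrow> (\<forall>q\<in>L1 \<Lambda> \<inter> Linf \<Lambda>. G q = ?F z q)"
      using D z by (intro ball_cong) auto
    then show ?thesis
      using L1_extension_unique[OF L1_bounded_linear_imp_continuous[OF L1_bounded_linear_fourier_laplace]] z
      by simp
  qed
  show ?thesis
    using der D ext absolutely_integrable_mult_exp L1_bounded_linear_fourier_laplace
    by (intro conjI ballI allI impI) (auto intro: differentiableI_vector)
qed

end
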